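(* The 1-round position-verification scheme $\mathsf{PV}_{\mathrm{BB84}}$ (described in the context) is $\varepsilon$-sound in the No-PE model with $\varepsilon=1-h^{-1}(\tfrac12)$.
   Context: $h(p)=-p\log_2 p-(1-p)\log_2(1-p)$ (with $h(0)=h(1)=0$) is the binary entropy function and $h^{-1}:[0,1]\to[0,\tfrac12]$ is its inverse on the branch $0\le p\le\tfrac12$. $H$ is the $2\times2$ Hadamard matrix; measuring in basis $\theta\in\{0,1\}$ means measuring in the orthonormal basis $\{H^\theta|0\rangle,H^\theta|1\rangle\}$. Model. Verifiers $V_0,V_1$ are at fixed positions $\mathit{pos}_0,\mathit{pos}_1$ on a line and the claimed position $\mathit{pos}$ of the prover lies on the segment between them. Messages travel at speed $1$; local computation takes no time; everything is noise-free. The verifiers have synchronized clocks and a private authenticated channel between them. Dishonest provers $\hat P_0,\dots,\hat P_\ell$ (any finite number) at arbitrary positions all different from $\mathit{pos}$ may perform arbitrary quantum operations, intercept the verifiers' messages, and exchange classical and quantum messages among themselves at speed $1$. They share no secret with the verifiers. No-PE (no pre-shared entanglement) model: the dishonest provers enter every round initiated by the verifiers with no entanglement shared among them; in every round a dishonest prover can send an entangled quantum state only after receiving the verifier's message of that round, and entanglement cannot be kept for use in a later round. Scheme $\mathsf{PV}_{\mathrm{BB84}}$: (0) $V_0$ chooses uniformly random bits $x,\theta\in\{0,1\}$ and privately sends them to $V_1$. (1) $V_0$ prepares the qubit $H^\theta|x\rangle$ and sends it to $P$, and $V_1$ sends the bit $\theta$ to $P$, timed so that both arrive at $\mathit{pos}$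 at the same time $T$. (2) On arrival, $P$ measures the qubit in basis $\theta$ to observe $x'\in\{0,1\}$ and immediately sends $x'$ to $V_0$ and $V_1$. (3) $V_0$ and $V_1$ accept iff on both sides $x'$ arrives in time (at $V_i$ at time $T+d(\mathit{pos}_i,\mathit{pos})$, with $d$ the distance) and $x'=x$. $\varepsilon$-sound: for every $\mathit{pos}$ in the convex hull of the verifiers' positions and every coalition of dishonest provers at positions all different from $\mathit{pos}$ (with no honest prover involved), the verifiers accept with probability at most $\varepsilon$. *)

theory Defs
  imports "HOL-Analysis.Analysis"
begin

text \<open>The conventions \<^prop>\<open>log 2 0 = (0::real)\<close> and \<open>0 * y = 0\<close> give \<open>h 0 = h 1 = 0\<close>.\<close>

definition bin_entropy :: "real \<Rightarrow> real" where
  "bin_entropy p = - p * log 2 p - (1 - p) * log 2 (1 - p)"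

definition bin_entropy_inv :: "real \<Rightarrow> real" where
  "bin_entropy_inv = the_inv_into {0..1/2} bin_entropy"

text \<open>
  The quantum systems that occur in a round.  \<open>Qubit\<close> is the system sent by \<open>V\<^sub>0\<close> and \<open>Basis\<close> the
  one sent by \<open>V\<^sub>1\<close>.  \<open>Held i k\<close> is a system in the memory of dishonest prover \<open>i\<close> when the first
  message of the verifiers reaches it.  \<open>Early k\<close> is a message that a dishonest prover sent before
  the verifiers' messages reached it and that no other prover has taken into its memory by then.
\<close>

datatype reg = Qubit | Basis | Held nat nat | Early nat

text \<open>
  A computational basis state of a set of registers assigns a value below its dimension to each
  register of the set (and \<^const>\<open>undefined\<close> outside of it).  An operator is given by its matrix
  in this basis; only the entries indexed by basis states are relevant.
\<close>

type_synonym basis_state = "reg \<Rightarrow> nat"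
type_synonym operator = "basis_state \<Rightarrow> basis_state \<Rightarrow> complex"

definition basis_states :: "(reg \<Rightarrow> nat) \<Rightarrow> reg set \<Rightarrow> basis_state set" where
  "basis_states D S = (\<Pi>\<^sub>E r\<in>S. {..<D r})"

definition density :: "(reg \<Rightarrow> nat) \<Rightarrow> reg set \<Rightarrow> operator \<Rightarrow> bool" where
  "density D S \<rho> \<longleftrightarrow>
     (\<forall>v :: basis_state \<Rightarrow> complex.
        (\<Sum>a\<in>basis_states D S. \<Sum>b\<in>basis_states D S. cnj (v a) * \<rho> a b * v b) \<in> \<real> \<and>
        0 \<le> Re (\<Sum>a\<in>basis_states D S. \<Sum>b\<in>basis_states D S. cnj (v a) * \<rho> a b * v b)) \<and>
     (\<Sum>a\<in>basis_states D S. \<rho> a a) = 1"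

text \<open>
  No entanglement between the blocks of a partition \<open>P\<close> of the registers: a finite convex
  combination of products of density operators of the blocks.  The states may be classically
  correlated, and there may be entanglement inside a block.
\<close>

definition separable :: "(reg \<Rightarrow> nat) \<Rightarrow> reg set set \<Rightarrow> operator \<Rightarrow> bool" where
  "separable D P \<sigma> \<longleftrightarrow>
     (\<exists>(n::nat) (w :: nat \<Rightarrow> real) (\<tau> :: nat \<Rightarrow> reg set \<Rightarrow> operator).
        (\<forall>j<n. 0 \<le> w j) \<and> (\<Sum>j<n. w j) = 1 \<and>
        (\<forall>j<n. \<forall>S\<in>P. density D S (\<tau> j S)) \<and>
        (\<forall>a\<in>basis_states D (\<Union>P). \<forall>b\<in>basis_states D (\<Union>P).
           \<sigma> a b = (\<Sum>j<n. of_real (w j) * (\<Prod>S\<in>P. \<tau> j S (restrict a S) (restrict b S)))))"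

text \<open>Quantum operations in operator-sum form: Kraus operators \<open>K\<close> with \<open>\<Sum> K\<^sup>\<dagger> K = I\<close>.\<close>

definition kraus_operation :: "(reg \<Rightarrow> nat) \<Rightarrow> reg set \<Rightarrow> operator list \<Rightarrow> bool" where
  "kraus_operation D S Ks \<longleftrightarrow>
     (\<forall>a\<in>basis_states D S. \<forall>b\<in>basis_states D S.
        (\<Sum>K\<leftarrow>Ks. \<Sum>c\<in>basis_states D S. cnj (K c a) * K c b) = (if a = b then 1 else 0))"

text \<open>\<open>K \<otimes> I\<close>, where \<open>K\<close> acts on \<open>S\<close> and the identity acts on \<open>R - S\<close>.\<close>

definition extend_op :: "reg set \<Rightarrow> reg set \<Rightarrow> operator \<Rightarrow> operator" where
  "extend_op R S K = (\<lambda>a b.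
     if restrict a (R - S) = restrict b (R - S) then K (restrict a S) (restrict b S) else 0)"

definition apply_kraus ::
    "(reg \<Rightarrow> nat) \<Rightarrow> reg set \<Rightarrow> reg set \<Rightarrow> operator list \<Rightarrow> operator \<Rightarrow> operator" where
  "apply_kraus D R S Ks \<rho> = (\<lambda>a b.
     \<Sum>K\<leftarrow>Ks. \<Sum>c\<in>basis_states D R. \<Sum>d\<in>basis_states D R.
       extend_op R S K a c * \<rho> c d * cnj (extend_op R S K b d))"

text \<open>An event is a pair of a position on the line and a time.\<close>

type_synonym event = "real \<times> real"

definition reaches :: "event \<Rightarrow> event \<Rightarrow> bool" where
  "reaches e f \<longleftrightarrow> dist (fst e) (fst f) \<le> snd f - snd e"

text \<open>
  \<open>arrival\<close> is the time at which the messages of both verifiers arrive at the claimed position.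
\<close>

record geometry =
  pos0 :: real
  pos1 :: real
  claimed :: real
  arrival :: real

definition emission0 :: "geometry \<Rightarrow> event" where
  "emission0 g = (pos0 g, arrival g - dist (pos0 g) (claimed g))"

definition emission1 :: "geometry \<Rightarrow> event" where
  "emission1 g = (pos1 g, arrival g - dist (pos1 g) (claimed g))"

definition deadline0 :: "geometry \<Rightarrow> event" where
  "deadline0 g = (pos0 g, arrival g + dist (pos0 g) (claimed g))"

definition deadline1 :: "geometry \<Rightarrow> event" where
  "deadline1 g = (pos1 g, arrival g + dist (pos1 g) (claimed g))"

text \<open>The first moment at which a message of one of the verifiers can be received at \<open>p\<close>.\<close>

definition reception :: "geometry \<Rightarrow> real \<Rightarrow> event" where
  "reception g p =
     (p, min (snd (emission0 g) + dist (pos0 g) p) (snd (emission1 g) + dist (pos1 g) p))"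

text \<open>
  A step of a coalition: prover \<open>actor\<close> applies, at time \<open>time\<close>, the quantum operation with Kraus
  operators \<open>kraus\<close> to the registers \<open>acted\<close>.  Registers are carried between the steps: that two
  steps use the same register means that this register is kept or sent from the one to the other.
  Fresh ancillas are unused registers of \<open>memory\<close>, measurement results are written to registers,
  and the schedule may be taken to be fixed since operations can be controlled on registers.
\<close>

record step =
  actor :: nat
  time :: real
  acted :: "reg set"
  kraus :: "operator list"

text \<open>
  The provers are numbered \<open>0, \<dots>, num_provers - 1\<close>.  \<open>memory\<close> is the set of all registers other than the
  two messages of the verifiers, and \<open>initial\<close> is its state.  \<open>answer0\<close> and \<open>answer1\<close> are the
  registers which are delivered to \<open>V\<^sub>0\<close> and \<open>V\<^sub>1\<close>.
\<close>

record coalition =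
  num_provers :: nat
  location :: "nat \<Rightarrow> real"
  dimension :: "reg \<Rightarrow> nat"
  memory :: "reg set"
  initial :: operator
  steps :: "step list"
  answer0 :: reg
  answer1 :: reg

definition registers :: "coalition \<Rightarrow> reg set" where
  "registers C = {Qubit, Basis} \<union> memory C"

definition step_event :: "coalition \<Rightarrow> step \<Rightarrow> event" where
  "step_event C s = (location C (actor s), time s)"

text \<open>
  Where and when a register starts to travel.  A system in the memory of a prover may be entangled
  with the rest of that memory, so it can be sent only after the reception of a message of
  the verifiers.  An early message is not entangled with anything and there is no bound on how early
  it was sent.
\<close>

fun available :: "geometry \<Rightarrow> coalition \<Rightarrow> reg \<Rightarrow> event \<Rightarrow> bool" where
  "available g C Qubit e = reaches (emission0 g) e"
| "available g C Basis e = reaches (emission1 g) e"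
| "available g C (Held i k) e = reaches (reception g (location C i)) e"
| "available g C (Early k) e = True"

definition memory_blocks :: "coalition \<Rightarrow> reg set set" where
  "memory_blocks C =
     {memory C \<inter> range (Held i) |i. i < num_provers C} \<union> {{Early k} |k. Early k \<in> memory C}"

text \<open>
  What the provers do before they receive a message of the verifiers is independent of the round, and
  it is accounted for by \<open>initial\<close>: arbitrary local operations, shared randomness and the exchange of
  classical and unentangled quantum messages lead to a state that is separable with respect to
  \<^const>\<open>memory_blocks\<close>.  The steps are those taken from the reception on.  They are listed in an order
  of execution; only the order of steps with a common register matters, and a register passes from
  one step to a later one at speed at most \<open>1\<close>.
\<close>

definition no_PE_coalition :: "geometry \<Rightarrow> coalition \<Rightarrow> bool" where
  "no_PE_coalition g C \<longleftrightarrow>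
     0 < num_provers C \<and>
     (\<forall>i<num_provers C. location C i \<noteq> claimed g) \<and>
     finite (memory C) \<and>
     memory C \<subseteq> (\<Union>i<num_provers C. range (Held i)) \<union> range Early \<and>
     dimension C Qubit = 2 \<and> dimension C Basis = 2 \<and>
     separable (dimension C) (memory_blocks C) (initial C) \<and>
     (\<forall>s\<in>set (steps C).
        actor s < num_provers C \<and>
        reaches (reception g (location C (actor s))) (step_event C s) \<and>
        acted s \<subseteq> registers C \<and>
        (\<forall>r\<in>acted s. available g C r (step_event C s)) \<and>
        kraus_operation (dimension C) (acted s) (kraus s)) \<and>
     (\<forall>k l. k < l \<longrightarrow> l < length (steps C) \<longrightarrow> acted (steps C ! k) \<inter> acted (steps C ! l) \<noteq> {} \<longrightarrow>
        reaches (step_event C (steps C ! k)) (step_event C (steps C ! l))) \<and>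
     answer0 C \<in> registers C \<and> answer1 C \<in> registers C \<and> answer0 C \<noteq> answer1 C"

definition run :: "coalition \<Rightarrow> operator \<Rightarrow> operator" where
  "run C \<rho> = fold (\<lambda>s. apply_kraus (dimension C) (registers C) (acted s) (kraus s)) (steps C) \<rho>"

text \<open>
  A scheme enters only through the probability with which the verifiers accept a coalition.
\<close>

definition sound_no_PE :: "real \<Rightarrow> real \<Rightarrow> (geometry \<Rightarrow> coalition \<Rightarrow> real) \<Rightarrow> real \<Rightarrow> bool" where
  "sound_no_PE p0 p1 accept \<epsilon> \<longleftrightarrow>
     (\<forall>pos \<in> convex hull {p0, p1}. \<forall>T C.
        let g = \<lparr>pos0 = p0, pos1 = p1, claimed = pos, arrival = T\<rparr> in
        no_PE_coalition g C \<longrightarrow> accept g C \<le> \<epsilon>)"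

definition hadamard :: "nat \<Rightarrow> nat \<Rightarrow> complex" where
  "hadamard y x = (- 1) ^ (x * y) / of_real (sqrt 2)"

text \<open>The amplitudes of \<open>H\<^sup>\<theta>|x\<rangle>\<close> for bits \<open>x\<close> and \<open>\<theta>\<close>.\<close>

definition bb84_state :: "nat \<Rightarrow> nat \<Rightarrow> nat \<Rightarrow> complex" where
  "bb84_state \<theta> x y = (if \<theta> = 0 then (if y = x then 1 else 0) else hadamard y x)"

definition bb84_input :: "coalition \<Rightarrow> nat \<Rightarrow> nat \<Rightarrow> operator" where
  "bb84_input C x \<theta> = (\<lambda>a b.
     bb84_state \<theta> x (a Qubit) * cnj (bb84_state \<theta> x (b Qubit)) *
     (if a Basis = \<theta> \<and> b Basis = \<theta> then 1 else 0) *
     initial C (restrict a (memory C)) (restrict b (memory C)))"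

text \<open>The system \<open>r\<close>, as left by all the steps that act on it, can be delivered at the event \<open>e\<close>.\<close>

definition in_time :: "geometry \<Rightarrow> coalition \<Rightarrow> reg \<Rightarrow> event \<Rightarrow> bool" where
  "in_time g C r e \<longleftrightarrow> available g C r e \<and>
     (\<forall>s\<in>set (steps C). r \<in> acted s \<longrightarrow> reaches (step_event C s) e)"

text \<open>
  The verifiers read the answers in the computational basis.  An answer register may have further
  values besides \<open>0\<close> and \<open>1\<close>; these are rejected.
\<close>

definition PV_BB84_accept :: "geometry \<Rightarrow> coalition \<Rightarrow> real" where
  "PV_BB84_accept g C =
     (if in_time g C (answer0 C) (deadline0 g) \<and> in_time g C (answer1 C) (deadline1 g)
      then \<Sum>x\<in>{0,1}. \<Sum>\<theta>\<in>{0,1}. 1/4 *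
        Re (\<Sum>a | a \<in> basis_states (dimension C) (registers C) \<and>
                 a (answer0 C) = x \<and> a (answer1 C) = x.
              run C (bb84_input C x \<theta>) a a)
      else 0)"

end

theory Submission
  imports Defs "HOL-Library.Complex_Order"
begin

text \<open>
  For \<open>\<theta> = 0\<close> only check the answer to \<open>V\<^sub>0\<close>, and for \<open>\<theta> = 1\<close> only the answer to \<open>V\<^sub>1\<close>.  What is
  done to the qubit in time for both deadlines is done without knowledge of \<open>\<theta>\<close>, because nobody is at the
  claimed position; from then on the two answers depend on disjoint parts of the systems that
  emerged from the qubit.  The other systems carry \<open>\<theta>\<close> but were never entangled with the qubit, so
  they can be prepared twice, once for \<open>\<theta> = 0\<close> and once for \<open>\<theta> = 1\<close>.  Hence the answer to \<open>V\<^sub>0\<close> for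
  \<open>\<theta> = 0\<close> and the answer to \<open>V\<^sub>1\<close> for \<open>\<theta> = 1\<close> form one joint measurement \<open>G x y\<close> of the qubit, and the
  acceptance probability is at most a quarter of the sum of the traces of
  \<open>G x y * (|x\<rangle>\<langle>x| + H|y\<rangle>\<langle>y|H)\<close>.  The second factor is at most \<open>7/4\<close>, which gives the bound \<open>7/8\<close>; and
  \<open>bin_entropy (1/8) \<ge> 1/2\<close>.
\<close>

subsection \<open>Positive semidefinite kernels\<close>

text \<open>The geometric obstacle is that \<theta> may be known near V1 while the qubit is still on
  its way. In light-cone coordinates around the arrival event, a step that follows some verifier's
  message and precedes both deadlines lies on one of two rays: u = 0, v < 0, the path of the qubit,
  or u < 0, v = 0, the path of \<theta>. The rays could meet only at the claimed position, where
  there is no prover. No-PE enters at this point: a memory block touched on the first ray is never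
  touched on the second. Held memory touched on both would have to leave its prover before any
  message is received there, and an early message is a single register that cannot visit both rays.
  In each term of the separable decomposition the blocks of the first ray are therefore in a product
  state with all the others, and resetting the others leaves them intact. As for the constant, 7/8
  is a rational between the optimum 1/2 + 1/sqrt 8, about 0.854, and 1 - h^{-1}(1/2), about 0.890;
  with it the operator inequality and the entropy estimate become rational arithmetic.\<close>

definition psd :: "'a set \<Rightarrow> ('a \<Rightarrow> 'a \<Rightarrow> complex) \<Rightarrow> bool" where
  "psd I \<kappa> \<longleftrightarrow> (\<forall>v. 0 \<le> (\<Sum>a\<in>I. \<Sum>b\<in>I. cnj (v a) * \<kappa> a b * v b))"

lemma psdD: "psd I \<kappa> \<Longrightarrow> 0 \<le> (\<Sum>a\<in>I. \<Sum>b\<in>I. cnj (v a) * \<kappa> a b * v b)"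
  unfolding psd_def by blast

lemma cnj_mult_self_nonneg: "0 \<le> cnj z * (z::complex)"
  by (simp add: less_eq_complex_def)

text \<open>The quadratic form becomes a sum over k of squared moduli of inner products of V k with
  v. Together with the converse \<open>psd_gram\<close>, positivity turns into a factorisation that
  is easy to transport through products and congruences.\<close>

lemma psd_of_gram:
  assumes "\<And>a b. a \<in> I \<Longrightarrow> b \<in> I \<Longrightarrow> \<kappa> a b = (\<Sum>k\<in>K. V k a * cnj (V k b))"
  shows "psd I \<kappa>"
  unfolding psd_def
proof
  fix v :: "'a \<Rightarrow> complex"
  have "(\<Sum>a\<in>I. \<Sum>b\<in>I. cnj (v a) * \<kappa> a b * v b)
      = (\<Sum>a\<in>I. \<Sum>b\<in>I. \<Sum>k\<in>K. (cnj (v a) * V k a) * (cnj (V k b) * v b))"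
    by (intro sum.cong refl) (simp add: assms sum_distrib_left sum_distrib_right mult_ac)
  also have "\<dots> = (\<Sum>a\<in>I. \<Sum>k\<in>K. \<Sum>b\<in>I. (cnj (v a) * V k a) * (cnj (V k b) * v b))"
    by (intro sum.cong refl sum.swap)
  also have "\<dots> = (\<Sum>k\<in>K. \<Sum>a\<in>I. \<Sum>b\<in>I. (cnj (v a) * V k a) * (cnj (V k b) * v b))"
    by (rule sum.swap)
  also have "\<dots> = (\<Sum>k\<in>K. cnj (\<Sum>b\<in>I. cnj (V k b) * v b) * (\<Sum>b\<in>I. cnj (V k b) * v b))"
    unfolding cnj_sum sum_product by (intro sum.cong refl) (simp add: mult_ac)
  finally show "0 \<le> (\<Sum>a\<in>I. \<Sum>b\<in>I. cnj (v a) * \<kappa> a b * v b)"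
    by (simp only: sum_nonneg cnj_mult_self_nonneg)
qed

lemma psd_subset:
  assumes "psd I \<kappa>" "J \<subseteq> I" "finite I"
  shows "psd J \<kappa>"
  unfolding psd_def
proof
  fix v :: "'a \<Rightarrow> complex"
  let ?w = "\<lambda>a. if a \<in> J then v a else 0"
  have inner: "(\<Sum>b\<in>I. cnj (?w a) * \<kappa> a b * ?w b) = (\<Sum>b\<in>J. cnj (?w a) * \<kappa> a b * v b)" for a
    by (rule sum.mono_neutral_cong_right) (use assms in auto)
  have "(\<Sum>a\<in>I. \<Sum>b\<in>I. cnj (?w a) * \<kappa> a b * ?w b) = (\<Sum>a\<in>J. \<Sum>b\<in>J. cnj (v a) * \<kappa> a b * v b)"
    unfolding inner by (rule sum.mono_neutral_cong_right) (use assms in auto)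
  then show "0 \<le> (\<Sum>a\<in>J. \<Sum>b\<in>J. cnj (v a) * \<kappa> a b * v b)"
    using psdD[OF assms(1), of ?w] by simp
qed

lemma psd_diag:
  assumes "psd I \<kappa>" "finite I" "a \<in> I"
  shows "0 \<le> \<kappa> a a"
  using psdD[OF psd_subset[OF assms(1) _ assms(2), of "{a}"], of "\<lambda>_. 1"] assms(3) by simp

lemma psd_pair:
  assumes "psd I \<kappa>" "finite I" "a \<in> I" "b \<in> I" "a \<noteq> b"
  shows "0 \<le> cnj s * \<kappa> a a * s + cnj s * \<kappa> a b * t + cnj t * \<kappa> b a * s + cnj t * \<kappa> b b * t"
  using psdD[OF psd_subset[OF assms(1) _ assms(2), of "{a,b}"], of "\<lambda>x. if x = a then s else t"] assms(3-5)
  by (simp add: add_ac)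

text \<open>In the complex order \<open>0 \<le> z\<close> also says that z is real, so the form has
  no imaginary part on any vector; the vectors (1, 1) and (1, i) on {a, b} separate the two parts of
  the off-diagonal entries.\<close>

lemma psd_hermitian:
  assumes "psd I \<kappa>" "finite I" "a \<in> I" "b \<in> I"
  shows "\<kappa> b a = cnj (\<kappa> a b)"
proof (cases "a = b")
  case True
  then show ?thesis using psd_diag[OF assms(1,2,3)] by (auto intro!: complex_eqI simp: less_eq_complex_def)
next
  case False
  have d: "Im (\<kappa> a a) = 0" "Im (\<kappa> b b) = 0"
    using psd_diag[OF assms(1,2,3)] psd_diag[OF assms(1,2,4)] by (simp_all add: less_eq_complex_def)
  have "Im (\<kappa> a b) + Im (\<kappa> b a) = 0"
    using psd_pair[OF assms False, of 1 1] d by (simp add: less_eq_complex_def)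
  moreover have "Re (\<kappa> a b) - Re (\<kappa> b a) = 0"
    using psd_pair[OF assms False, of 1 \<i>] d by (simp add: less_eq_complex_def)
  ultimately show ?thesis by (intro complex_eqI) simp_all
qed

lemma psd_zero_diag:
  assumes "psd I \<kappa>" "finite I" "a \<in> I" "b \<in> I" "\<kappa> a a = 0"
  shows "\<kappa> a b = 0"
proof (cases "a = b")
  case False
  let ?n = "(cmod (\<kappa> a b))\<^sup>2"
  have herm: "\<kappa> b a = cnj (\<kappa> a b)" by (rule psd_hermitian[OF assms(1-4)])
  \<comment> \<open>The test vector is -x \<kappa> a b at a and 1 at b. Since \<kappa> a a = 0, no
    quadratic term in x appears, and an affine function that is bounded below has slope 0.\<close>
  have *: "0 \<le> Re (\<kappa> b b) - 2 * x * ?n" for x :: real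
    using psd_pair[OF assms(1-4) False, of "- of_real x * \<kappa> a b" 1]
    unfolding cmod_power2
    by (simp add: assms(5) herm less_eq_complex_def power2_eq_square algebra_simps)
  have "?n = 0"
  proof (rule ccontr)
    assume "?n \<noteq> 0"
    then have "2 * ((Re (\<kappa> b b) + 1) / ?n) * ?n = 2 * (Re (\<kappa> b b) + 1)" by simp
    then have "0 \<le> Re (\<kappa> b b) - 2 * (Re (\<kappa> b b) + 1)"
      using *[of "(Re (\<kappa> b b) + 1) / ?n"] by simp
    then show False using *[of 0] by simp
  qed
  then show ?thesis by simp
qed (use assms in simp)

text \<open>Cholesky factorisation: each step splits off a column and leaves the Schur complement.\<close>

lemma psd_gram:
  assumes "finite I" "psd I \<kappa>"
  shows "\<exists>(n::nat) V. \<forall>a\<in>I. \<forall>b\<in>I. \<kappa> a b = (\<Sum>k<n. V k a * cnj (V k b))"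
  using assms
proof (induction I arbitrary: \<kappa> rule: finite_induct)
  case empty
  then show ?case by simp
next
  case (insert i I)
  have fin: "finite (insert i I)" using insert.hyps by simp
  note herm = psd_hermitian[OF insert.prems fin]
  show ?case
  proof (cases "\<kappa> i i = 0")
    case True
    have "psd I \<kappa>" using psd_subset[OF insert.prems _ fin] by blast
    then obtain n :: nat and V where V: "\<And>a b. a\<in>I \<Longrightarrow> b\<in>I \<Longrightarrow> \<kappa> a b = (\<Sum>k<n. V k a * cnj (V k b))"
      using insert.IH by metis
    have z: "\<kappa> i b = 0" "\<kappa> b i = 0" if "b \<in> insert i I" for b
      using psd_zero_diag[OF insert.prems fin _ that True] herm[of i b] that by auto
    have "\<kappa> a b = (\<Sum>k<n. ((V k)(i := 0)) a * cnj (((V k)(i := 0)) b))"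
      if "a \<in> insert i I" "b \<in> insert i I" for a b
    proof (cases "a = i \<or> b = i")
      case True
      then show ?thesis using z that by auto
    next
      case False
      then show ?thesis using V[of a b] that by simp
    qed
    then show ?thesis by (intro exI[of _ n] exI[of _ "\<lambda>k. (V k)(i := 0)"]) blast
  next
    case False
    define d where "d = \<kappa> i i"
    have dpos: "0 \<le> d" "d \<noteq> 0" using psd_diag[OF insert.prems fin, of i] False by (auto simp: d_def)
    define s where "s = complex_of_real (sqrt (Re d))"
    have ss: "s * s = d" "cnj s = s"
    proof -
      have "0 \<le> Re d" "d = of_real (Re d)" using dpos by (auto simp: complex_eq_iff less_eq_complex_def)
      then show "s * s = d" "cnj s = s" unfolding s_def of_real_mult[symmetric] by simp_all
    qed
    define \<mu> where "\<mu> a b = \<kappa> a b - \<kappa> a i * \<kappa> i b / d" for a b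
    have "psd I \<mu>"
      unfolding psd_def
    proof
      fix v :: "'a \<Rightarrow> complex"
      define r where "r = (\<Sum>b\<in>I. \<kappa> i b * v b)"
      define l where "l = (\<Sum>a\<in>I. cnj (v a) * \<kappa> a i)"
      define Q where "Q = (\<Sum>a\<in>I. \<Sum>b\<in>I. cnj (v a) * \<kappa> a b * v b)"
      \<comment> \<open>The minimiser of the form in its coordinate i; completing the square leaves
        the form of the Schur complement \<mu>.\<close>
      define z where "z = - r / d"
      define w where "w = v(i := z)"
      have cr: "cnj r = l"
        unfolding r_def l_def cnj_sum
      proof (intro sum.cong refl)
        fix a assume "a \<in> I"
        then show "cnj (\<kappa> i a * v a) = cnj (v a) * \<kappa> a i" using herm[of i a] by simp
      qed
      have cd: "cnj d = d" using dpos by (simp add: complex_eq_iff less_eq_complex_def)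
      have w: "w i = z" "\<And>a. a \<in> I \<Longrightarrow> w a = v a" using insert.hyps(2) by (auto simp: w_def)
      have "(\<Sum>b\<in>insert i I. cnj (w a) * \<kappa> a b * w b)
          = cnj (w a) * \<kappa> a i * z + (\<Sum>b\<in>I. cnj (w a) * \<kappa> a b * v b)" for a
        unfolding sum.insert[OF insert.hyps] w(1)
        by (intro arg_cong2[of _ _ _ _ "(+)"] refl sum.cong) (simp_all only: w(2))
      then have "(\<Sum>a\<in>insert i I. \<Sum>b\<in>insert i I. cnj (w a) * \<kappa> a b * w b)
          = (\<Sum>a\<in>insert i I. cnj (w a) * \<kappa> a i * z + (\<Sum>b\<in>I. cnj (w a) * \<kappa> a b * v b))"
        by (simp only:)
      also have "\<dots> = (cnj z * d * z + (\<Sum>b\<in>I. cnj z * \<kappa> i b * v b))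
          + (\<Sum>a\<in>I. cnj (v a) * \<kappa> a i * z + (\<Sum>b\<in>I. cnj (v a) * \<kappa> a b * v b))"
        unfolding sum.insert[OF insert.hyps] w(1) d_def
        by (intro arg_cong2[of _ _ _ _ "(+)"] refl sum.cong) (simp_all only: w(2))
      also have "(\<Sum>a\<in>I. cnj (v a) * \<kappa> a i * z + (\<Sum>b\<in>I. cnj (v a) * \<kappa> a b * v b)) = l * z + Q"
        by (simp only: sum.distrib l_def Q_def sum_distrib_right)
      also have "(\<Sum>b\<in>I. cnj z * \<kappa> i b * v b) = cnj z * r"
        by (simp only: r_def sum_distrib_left mult.assoc)
      also have "cnj z * d * z + cnj z * r + (l * z + Q) = Q - l * r / d"
      proof -
        have "cnj z = - l / d" by (simp add: z_def cr cd)
        show ?thesis unfolding \<open>cnj z = - l / d\<close> using dpos(2) by (simp add: z_def)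
      qed
      also have "l * r / d = (\<Sum>a\<in>I. \<Sum>b\<in>I. cnj (v a) * (\<kappa> a i * \<kappa> i b / d) * v b)"
        unfolding l_def r_def sum_product sum_divide_distrib by (intro sum.cong refl) (simp add: mult_ac)
      also have "Q - \<dots> = (\<Sum>a\<in>I. \<Sum>b\<in>I. cnj (v a) * \<mu> a b * v b)"
        unfolding Q_def \<mu>_def by (simp add: sum_subtractf algebra_simps)
      finally show "0 \<le> (\<Sum>a\<in>I. \<Sum>b\<in>I. cnj (v a) * \<mu> a b * v b)"
        using psdD[OF insert.prems, of w] by simp
    qed
    then obtain n :: nat and V where V: "\<And>a b. a\<in>I \<Longrightarrow> b\<in>I \<Longrightarrow> \<mu> a b = (\<Sum>k<n. V k a * cnj (V k b))"
      using insert.IH by metis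
    \<comment> \<open>Index n holds the column split off at the pivot i; the columns of the
      induction hypothesis vanish at i.\<close>
    define W where "W k = (if k < n then (V k)(i := 0) else (\<lambda>a. \<kappa> a i / s))" for k
    have "\<kappa> a b = (\<Sum>k<Suc n. W k a * cnj (W k b))"
      if a: "a \<in> insert i I" and b: "b \<in> insert i I" for a b
    proof -
      have "cnj (\<kappa> b i) = \<kappa> i b" using herm[OF b, of i] by simp
      then have last: "W n a * cnj (W n b) = \<kappa> a i * \<kappa> i b / d"
        unfolding ss(1)[symmetric] W_def by (simp add: ss(2))
      have rest: "(\<Sum>k<n. W k a * cnj (W k b)) = (if a = i \<or> b = i then 0 else \<mu> a b)"
      proof (cases "a = i \<or> b = i")
        case False
        then show ?thesis using V[of a b] a b by (simp add: W_def)
      qed (auto simp: W_def intro!: sum.neutral)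
      show ?thesis
        unfolding sum.lessThan_Suc last rest using dpos(2) by (auto simp: \<mu>_def d_def)
    qed
    then show ?thesis by blast
  qed
qed

text \<open>Gram vectors can be composed with any g, in particular with the restriction of joint
  basis states to a block, which is not injective.\<close>

lemma psd_pullback:
  assumes "psd J \<kappa>" "finite J" "\<And>a. a \<in> I \<Longrightarrow> g a \<in> J"
  shows "psd I (\<lambda>a b. \<kappa> (g a) (g b))"
proof -
  obtain n :: nat and V where "\<And>a b. a\<in>J \<Longrightarrow> b\<in>J \<Longrightarrow> \<kappa> a b = (\<Sum>k<n. V k a * cnj (V k b))"
    using psd_gram[OF assms(2,1)] by metis
  then show ?thesis
    by (intro psd_of_gram[where V = "\<lambda>k a. V k (g a)" and K = "{..<n}"]) (use assms(3) in auto)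
qed

text \<open>Tensor products of Gram vectors are Gram vectors of the entrywise product. Product
  states occur below as entrywise products of kernels on joint basis states.\<close>

lemma psd_schur_product:
  assumes "finite I" "psd I \<kappa>" "psd I \<mu>"
  shows "psd I (\<lambda>a b. \<kappa> a b * \<mu> a b)"
proof -
  obtain n :: nat and V where V: "\<And>a b. a\<in>I \<Longrightarrow> b\<in>I \<Longrightarrow> \<kappa> a b = (\<Sum>k<n. V k a * cnj (V k b))"
    using psd_gram[OF assms(1,2)] by metis
  obtain m :: nat and W where W: "\<And>a b. a\<in>I \<Longrightarrow> b\<in>I \<Longrightarrow> \<mu> a b = (\<Sum>k<m. W k a * cnj (W k b))"
    using psd_gram[OF assms(1,3)] by metis
  show ?thesis
  proof (rule psd_of_gram[where K = "{..<n} \<times> {..<m}" and V = "\<lambda>(k, l) a. V k a * W l a"])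
    fix a b assume "a \<in> I" "b \<in> I"
    then show "\<kappa> a b * \<mu> a b = (\<Sum>kl\<in>{..<n} \<times> {..<m}.
        (case kl of (k, l) \<Rightarrow> \<lambda>a. V k a * W l a) a * cnj ((case kl of (k, l) \<Rightarrow> \<lambda>a. V k a * W l a) b))"
      by (simp add: V W sum_product sum.cartesian_product case_prod_beta mult_ac)
  qed
qed

lemma psd_prod:
  assumes "finite I" "finite P" "\<And>S. S \<in> P \<Longrightarrow> psd I (\<kappa> S)"
  shows "psd I (\<lambda>a b. \<Prod>S\<in>P. \<kappa> S a b)"
  using assms(2,3)
proof (induction P rule: finite_induct)
  case empty
  then show ?case by (intro psd_of_gram[where K = "{()}" and V = "\<lambda>_ _. 1"]) simp
next
  case (insert S P)
  then show ?case using psd_schur_product[OF assms(1), of "\<kappa> S" "\<lambda>a b. \<Prod>S\<in>P. \<kappa> S a b"] by simp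
qed

lemma psd_congruence:
  assumes "psd I \<rho>" "finite I"
  shows "psd J (\<lambda>a b. \<Sum>c\<in>I. \<Sum>d\<in>I. M a c * \<rho> c d * cnj (M b d))"
proof -
  obtain n :: nat and V where V: "\<And>a b. a\<in>I \<Longrightarrow> b\<in>I \<Longrightarrow> \<rho> a b = (\<Sum>k<n. V k a * cnj (V k b))"
    using psd_gram[OF assms(2,1)] by metis
  show ?thesis
  proof (rule psd_of_gram)
    fix a b
    have "(\<Sum>c\<in>I. \<Sum>d\<in>I. M a c * \<rho> c d * cnj (M b d))
        = (\<Sum>c\<in>I. \<Sum>d\<in>I. \<Sum>k<n. (M a c * V k c) * cnj (M b d * V k d))"
      by (intro sum.cong refl) (simp add: V sum_distrib_left sum_distrib_right mult_ac)
    also have "\<dots> = (\<Sum>c\<in>I. \<Sum>k<n. \<Sum>d\<in>I. (M a c * V k c) * cnj (M b d * V k d))"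
      by (intro sum.cong refl sum.swap)
    also have "\<dots> = (\<Sum>k<n. \<Sum>c\<in>I. \<Sum>d\<in>I. (M a c * V k c) * cnj (M b d * V k d))"
      by (rule sum.swap)
    also have "\<dots> = (\<Sum>k<n. (\<Sum>c\<in>I. M a c * V k c) * cnj (\<Sum>c\<in>I. M b c * V k c))"
      by (simp only: sum_product cnj_sum)
    finally show "(\<Sum>c\<in>I. \<Sum>d\<in>I. M a c * \<rho> c d * cnj (M b d))
        = (\<Sum>k<n. (\<Sum>c\<in>I. M a c * V k c) * cnj (\<Sum>c\<in>I. M b c * V k c))" .
  qed
qed

lemma psd_sum_list:
  assumes "\<And>x. x \<in> set xs \<Longrightarrow> psd I (\<kappa> x)"
  shows "psd I (\<lambda>a b. \<Sum>x\<leftarrow>xs. \<kappa> x a b)"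
  using assms
  by (induction xs) (auto simp: psd_def distrib_left distrib_right sum.distrib intro!: add_nonneg_nonneg)

subsection \<open>Operators supported on a set of registers\<close>

lemma finite_basis_states: "finite S \<Longrightarrow> finite (basis_states D S)"
  unfolding basis_states_def by (rule finite_PiE) auto

lemma restrict_eq_iff: "restrict a S = restrict b S \<longleftrightarrow> (\<forall>r\<in>S. a r = b r)"
  by (metis restrict_apply' restrict_ext)

lemma restrict_basis_states: "a \<in> basis_states D R \<Longrightarrow> S \<subseteq> R \<Longrightarrow> restrict a S \<in> basis_states D S"
  unfolding basis_states_def by (auto simp: PiE_iff)

lemma basis_states_eqI:
  "a \<in> basis_states D S \<Longrightarrow> b \<in> basis_states D S \<Longrightarrow> (\<And>r. r \<in> S \<Longrightarrow> a r = b r) \<Longrightarrow> a = b"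
  unfolding basis_states_def by (rule PiE_ext)

lemma restrict_basis_states_id: "a \<in> basis_states D S \<Longrightarrow> restrict a S = a"
  unfolding basis_states_def by (rule PiE_restrict)

lemma override_basis_states:
  "a \<in> basis_states D R \<Longrightarrow> \<gamma> \<in> basis_states D S \<Longrightarrow> S \<subseteq> R \<Longrightarrow> override_on a \<gamma> S \<in> basis_states D R"
  unfolding basis_states_def by (auto simp: PiE_iff override_on_def extensional_def)

lemma restrict_override_same: "\<gamma> \<in> basis_states D S \<Longrightarrow> restrict (override_on a \<gamma> S) S = \<gamma>"
  by (rule basis_states_eqI) (auto simp: basis_states_def PiE_iff)

lemma restrict_override_disjoint: "S \<inter> T = {} \<Longrightarrow> restrict (override_on a \<gamma> T) S = restrict a S"
  by (auto simp: restrict_eq_iff override_on_def)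

lemma restrict_override_subset: "T \<subseteq> S \<Longrightarrow> restrict (override_on a \<gamma> T) S = override_on (restrict a S) \<gamma> T"
  by (auto simp: fun_eq_iff override_on_def)

lemma override_commute: "S \<inter> T = {} \<Longrightarrow> override_on (override_on a \<gamma> S) \<delta> T = override_on (override_on a \<delta> T) \<gamma> S"
  by (auto simp: fun_eq_iff override_on_def)

lemma extend_op_alt:
  "extend_op R S K a b = (if \<forall>r\<in>R-S. a r = b r then K (restrict a S) (restrict b S) else 0)"
  unfolding extend_op_def restrict_eq_iff ..

text \<open>The states that agree with a off S arise from a by overwriting its S-part. This
  collapses sums for an operator K \<otimes> I over all registers to sums over the registers of
  K.\<close>

lemma sum_agreeing_states:
  assumes "finite R" "S \<subseteq> R" "a \<in> basis_states D R"
  shows "(\<Sum>c\<in>basis_states D R. if \<forall>r\<in>R-S. a r = c r then \<phi> c else 0)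
       = (\<Sum>\<gamma>\<in>basis_states D S. \<phi> (override_on a \<gamma> S))"
proof -
  have "(\<Sum>c\<in>basis_states D R. if \<forall>r\<in>R-S. a r = c r then \<phi> c else 0)
      = sum \<phi> {c\<in>basis_states D R. \<forall>r\<in>R-S. a r = c r}"
    using finite_basis_states[OF assms(1)] by (rule sum.inter_filter[symmetric])
  also have "\<dots> = (\<Sum>\<gamma>\<in>basis_states D S. \<phi> (override_on a \<gamma> S))"
  proof (rule sum.reindex_bij_witness[where i = "\<lambda>\<gamma>. override_on a \<gamma> S" and j = "\<lambda>c. restrict c S"])
    fix c assume c: "c \<in> {c\<in>basis_states D R. \<forall>r\<in>R-S. a r = c r}"
    then show "restrict c S \<in> basis_states D S" using restrict_basis_states assms(2) by blast
    show eq: "override_on a (restrict c S) S = c"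
      using c assms by (intro basis_states_eqI[of _ D R] override_basis_states restrict_basis_states)
        (auto simp: override_on_def)
    show "\<phi> (override_on a (restrict c S) S) = \<phi> c" by (simp only: eq)
  next
    fix \<gamma> assume \<gamma>: "\<gamma> \<in> basis_states D S"
    show "restrict (override_on a \<gamma> S) S = \<gamma>" by (rule restrict_override_same[OF \<gamma>])
    show "override_on a \<gamma> S \<in> {c\<in>basis_states D R. \<forall>r\<in>R-S. a r = c r}"
      using override_basis_states[OF assms(3) \<gamma> assms(2)] by auto
  qed
  finally show ?thesis .
qed

lemma sum_extend_op:
  assumes "finite R" "S \<subseteq> R" "a \<in> basis_states D R"
  shows "(\<Sum>c\<in>basis_states D R. extend_op R S K a c * \<phi> c)
       = (\<Sum>\<gamma>\<in>basis_states D S. K (restrict a S) \<gamma> * \<phi> (override_on a \<gamma> S))"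
proof -
  have "(\<Sum>c\<in>basis_states D R. extend_op R S K a c * \<phi> c)
      = (\<Sum>c\<in>basis_states D R. if \<forall>r\<in>R-S. a r = c r then K (restrict a S) (restrict c S) * \<phi> c else 0)"
    by (intro sum.cong refl) (simp add: extend_op_alt)
  also have "\<dots> = (\<Sum>\<gamma>\<in>basis_states D S. K (restrict a S) (restrict (override_on a \<gamma> S) S) * \<phi> (override_on a \<gamma> S))"
    by (rule sum_agreeing_states[OF assms])
  finally show ?thesis by (simp add: restrict_override_same cong: sum.cong)
qed

lemma apply_kraus_local:
  assumes "finite R" "S \<subseteq> R" "a \<in> basis_states D R" "b \<in> basis_states D R"
  shows "apply_kraus D R S Ks \<rho> a b =
    (\<Sum>K\<leftarrow>Ks. \<Sum>\<gamma>\<in>basis_states D S. \<Sum>\<delta>\<in>basis_states D S.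
       K (restrict a S) \<gamma> * \<rho> (override_on a \<gamma> S) (override_on b \<delta> S) * cnj (K (restrict b S) \<delta>))"
proof -
  have "(\<Sum>c\<in>basis_states D R. \<Sum>d\<in>basis_states D R.
       extend_op R S K a c * \<rho> c d * cnj (extend_op R S K b d)) =
    (\<Sum>\<gamma>\<in>basis_states D S. \<Sum>\<delta>\<in>basis_states D S.
       K (restrict a S) \<gamma> * \<rho> (override_on a \<gamma> S) (override_on b \<delta> S) * cnj (K (restrict b S) \<delta>))" for K
  proof -
    have cnj: "cnj (extend_op R S K b d) = extend_op R S (\<lambda>x y. cnj (K x y)) b d" for d
      by (simp add: extend_op_alt)
    have "(\<Sum>c\<in>basis_states D R. \<Sum>d\<in>basis_states D R.
        extend_op R S K a c * \<rho> c d * cnj (extend_op R S K b d))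
      = (\<Sum>c\<in>basis_states D R. extend_op R S K a c *
          (\<Sum>d\<in>basis_states D R. extend_op R S (\<lambda>x y. cnj (K x y)) b d * \<rho> c d))"
      by (simp add: sum_distrib_left cnj mult_ac)
    also have "\<dots> = (\<Sum>\<gamma>\<in>basis_states D S. K (restrict a S) \<gamma> *
        (\<Sum>\<delta>\<in>basis_states D S. cnj (K (restrict b S) \<delta>) * \<rho> (override_on a \<gamma> S) (override_on b \<delta> S)))"
      unfolding sum_extend_op[OF assms(1,2,3)] sum_extend_op[OF assms(1,2,4)] ..
    finally show ?thesis by (simp add: sum_distrib_left mult_ac)
  qed
  then show ?thesis unfolding apply_kraus_def by simp
qed

section \<open>Observables and the dual (Heisenberg) action of operations\<close>

definition heisenberg :: "(reg \<Rightarrow> nat) \<Rightarrow> reg set \<Rightarrow> reg set \<Rightarrow> operator list \<Rightarrow> operator \<Rightarrow> operator" where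
  "heisenberg D R S Ks M = (\<lambda>a b.
     \<Sum>K\<leftarrow>Ks. \<Sum>c\<in>basis_states D R. \<Sum>d\<in>basis_states D R.
       cnj (extend_op R S K c a) * M c d * extend_op R S K d b)"

lemma heisenberg_local:
  assumes "finite R" "S \<subseteq> R" "a \<in> basis_states D R" "b \<in> basis_states D R"
  shows "heisenberg D R S Ks M a b =
    (\<Sum>K\<leftarrow>Ks. \<Sum>\<gamma>\<in>basis_states D S. \<Sum>\<delta>\<in>basis_states D S.
       cnj (K \<gamma> (restrict a S)) * M (override_on a \<gamma> S) (override_on b \<delta> S) * K \<delta> (restrict b S))"
proof -
  \<comment> \<open>The dual map is \<open>apply_kraus\<close> with conjugate-transposed Kraus
    operators, so the local formula carries over.\<close>
  have eq: "extend_op R S (\<lambda>x y. cnj (K y x)) a c = cnj (extend_op R S K c a)"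
    "extend_op R S (\<lambda>x y. cnj (K y x)) b d = cnj (extend_op R S K d b)" for K c d
    by (auto simp: extend_op_alt)
  show ?thesis
    using apply_kraus_local[OF assms, of "map (\<lambda>K x y. cnj (K y x)) Ks" M]
    by (simp add: apply_kraus_def heisenberg_def eq o_def)
qed

definition expect :: "(reg \<Rightarrow> nat) \<Rightarrow> reg set \<Rightarrow> operator \<Rightarrow> operator \<Rightarrow> complex" where
  "expect D R M \<rho> = (\<Sum>a\<in>basis_states D R. \<Sum>b\<in>basis_states D R. M a b * \<rho> b a)"

lemma expect_sum_list:
  "expect D R (\<lambda>a b. \<Sum>x\<leftarrow>xs. M x a b) \<rho> = (\<Sum>x\<leftarrow>xs. expect D R (M x) \<rho>)"
  by (induction xs) (simp_all add: expect_def sum.distrib distrib_right)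

lemma expect_sum_list':
  "expect D R M (\<lambda>a b. \<Sum>x\<leftarrow>xs. \<rho> x a b) = (\<Sum>x\<leftarrow>xs. expect D R M (\<rho> x))"
  by (induction xs) (simp_all add: expect_def sum.distrib distrib_left)

text \<open>Cyclicity of the trace. Moving operations to the observable lets locality be argued
  through the support of the observable.\<close>

lemma expect_apply_kraus:
  "expect D R M (apply_kraus D R S Ks \<rho>) = expect D R (heisenberg D R S Ks M) \<rho>"
  unfolding apply_kraus_def heisenberg_def expect_sum_list expect_sum_list'
proof (intro arg_cong[of _ _ sum_list] map_cong refl)
  fix K
  let ?B = "basis_states D R" and ?E = "extend_op R S K"
  have "(\<Sum>a\<in>?B. \<Sum>b\<in>?B. M a b * (\<Sum>c\<in>?B. \<Sum>d\<in>?B. ?E b c * \<rho> c d * cnj (?E a d)))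
     = (\<Sum>a\<in>?B. \<Sum>b\<in>?B. \<Sum>c\<in>?B. \<Sum>d\<in>?B. cnj (?E a d) * M a b * ?E b c * \<rho> c d)"
    by (simp add: sum_distrib_left mult_ac)
  also have "\<dots> = (\<Sum>a\<in>?B. \<Sum>b\<in>?B. \<Sum>d\<in>?B. \<Sum>c\<in>?B. cnj (?E a d) * M a b * ?E b c * \<rho> c d)"
    by (intro sum.cong refl sum.swap)
  also have "\<dots> = (\<Sum>a\<in>?B. \<Sum>d\<in>?B. \<Sum>b\<in>?B. \<Sum>c\<in>?B. cnj (?E a d) * M a b * ?E b c * \<rho> c d)"
    by (intro sum.cong refl sum.swap)
  also have "\<dots> = (\<Sum>d\<in>?B. \<Sum>a\<in>?B. \<Sum>b\<in>?B. \<Sum>c\<in>?B. cnj (?E a d) * M a b * ?E b c * \<rho> c d)"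
    by (rule sum.swap)
  also have "\<dots> = (\<Sum>d\<in>?B. \<Sum>a\<in>?B. \<Sum>c\<in>?B. \<Sum>b\<in>?B. cnj (?E a d) * M a b * ?E b c * \<rho> c d)"
    by (intro sum.cong refl sum.swap)
  also have "\<dots> = (\<Sum>d\<in>?B. \<Sum>c\<in>?B. \<Sum>a\<in>?B. \<Sum>b\<in>?B. cnj (?E a d) * M a b * ?E b c * \<rho> c d)"
    by (intro sum.cong refl sum.swap)
  finally show "expect D R M (\<lambda>a b. \<Sum>c\<in>?B. \<Sum>d\<in>?B. ?E a c * \<rho> c d * cnj (?E b d))
     = expect D R (\<lambda>a b. \<Sum>c\<in>?B. \<Sum>d\<in>?B. cnj (?E c a) * M c d * ?E d b) \<rho>"
    by (simp add: expect_def sum_distrib_right)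
qed

definition supported :: "(reg \<Rightarrow> nat) \<Rightarrow> reg set \<Rightarrow> reg set \<Rightarrow> operator \<Rightarrow> bool" where
  "supported D R S M \<longleftrightarrow>
     (\<exists>f. \<forall>a\<in>basis_states D R. \<forall>b\<in>basis_states D R. M a b = extend_op R S f a b)"

lemma supported_mono:
  assumes "supported D R S M" "S \<subseteq> T" "T \<subseteq> R"
  shows "supported D R T M"
proof -
  obtain f where f: "\<And>a b. a\<in>basis_states D R \<Longrightarrow> b\<in>basis_states D R \<Longrightarrow> M a b = extend_op R S f a b"
    using assms(1) unfolding supported_def by blast
  have r: "restrict (restrict a T) S = restrict a S" for a :: basis_state using assms(2) by (simp add: Int_absorb1)
  have "extend_op R S f a b = extend_op R T (extend_op T S f) a b" for a b
    unfolding extend_op_alt r using assms(2,3) by auto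
  then show ?thesis using f unfolding supported_def by metis
qed

text \<open>M is the identity on T, so the Kraus operators meet as \<Sum> K^dagger K next to M, and
  trace preservation makes this sum the identity.\<close>

lemma heisenberg_disjoint:
  assumes "finite R" "T \<subseteq> R" "S \<inter> T = {}" "S \<subseteq> R" "supported D R S M" "kraus_operation D T Ks"
    "a \<in> basis_states D R" "b \<in> basis_states D R"
  shows "heisenberg D R T Ks M a b = M a b"
proof -
  obtain f where f: "\<And>a b. a\<in>basis_states D R \<Longrightarrow> b\<in>basis_states D R \<Longrightarrow> M a b = extend_op R S f a b"
    using assms(5) unfolding supported_def by blast
  let ?B = "basis_states D T"
  \<comment> \<open>The entry of M between states that coincide on T and equal a and b elsewhere; it
    is the same for every common value on T.\<close>
  define \<mu> where "\<mu> = (if \<forall>r\<in>R-(S\<union>T). a r = b r then f (restrict a S) (restrict b S) else 0)"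
  have M: "M (override_on a \<gamma> T) (override_on b \<delta> T) = (if \<gamma> = \<delta> then \<mu> else 0)"
    if "\<gamma> \<in> ?B" "\<delta> \<in> ?B" for \<gamma> \<delta>
  proof -
    have "(\<forall>r\<in>R-S. override_on a \<gamma> T r = override_on b \<delta> T r) \<longleftrightarrow> \<gamma> = \<delta> \<and> (\<forall>r\<in>R-(S\<union>T). a r = b r)"
    proof
      assume l: "\<forall>r\<in>R-S. override_on a \<gamma> T r = override_on b \<delta> T r"
      have "\<gamma> r = \<delta> r" if "r \<in> T" for r using l[rule_format, of r] that assms(2,3) by auto
      moreover have "a r = b r" if "r \<in> R - (S \<union> T)" for r using l[rule_format, of r] that by auto
      ultimately show "\<gamma> = \<delta> \<and> (\<forall>r\<in>R-(S\<union>T). a r = b r)" using basis_states_eqI \<open>\<gamma> \<in> ?B\<close> \<open>\<delta> \<in> ?B\<close> by blast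
    qed (auto simp: override_on_def)
    then show ?thesis
      using that assms by (simp add: f override_basis_states extend_op_alt restrict_override_disjoint \<mu>_def)
  qed
  have "heisenberg D R T Ks M a b =
    (\<Sum>K\<leftarrow>Ks. \<Sum>\<gamma>\<in>?B. cnj (K \<gamma> (restrict a T)) * \<mu> * K \<gamma> (restrict b T))"
    unfolding heisenberg_local[OF assms(1,2,7,8)]
  proof (intro arg_cong[of _ _ sum_list] map_cong refl sum.cong)
    fix K :: operator and \<gamma> assume \<gamma>: "\<gamma> \<in> ?B"
    have "(\<Sum>\<delta>\<in>?B. cnj (K \<gamma> (restrict a T)) * M (override_on a \<gamma> T) (override_on b \<delta> T) * K \<delta> (restrict b T))
      = (\<Sum>\<delta>\<in>?B. if \<delta> = \<gamma> then cnj (K \<gamma> (restrict a T)) * \<mu> * K \<gamma> (restrict b T) else 0)"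
      using \<gamma> by (intro sum.cong refl) (auto simp: M)
    then show "(\<Sum>\<delta>\<in>?B. cnj (K \<gamma> (restrict a T)) * M (override_on a \<gamma> T) (override_on b \<delta> T) * K \<delta> (restrict b T))
      = cnj (K \<gamma> (restrict a T)) * \<mu> * K \<gamma> (restrict b T)"
      using \<gamma> finite_basis_states[OF finite_subset[OF assms(2,1)]] by simp
  qed
  also have "\<dots> = \<mu> * (\<Sum>K\<leftarrow>Ks. \<Sum>\<gamma>\<in>?B. cnj (K \<gamma> (restrict a T)) * K \<gamma> (restrict b T))"
    by (simp add: sum_distrib_left sum_list_const_mult[symmetric] mult_ac)
  also have "\<dots> = \<mu> * (if restrict a T = restrict b T then 1 else 0)"
    unfolding assms(6)[unfolded kraus_operation_def, rule_format,
      OF restrict_basis_states[OF assms(7,2)] restrict_basis_states[OF assms(8,2)]] ..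
  also have "\<dots> = M a b"
    using assms(2,3) f[OF assms(7,8)] by (auto simp: \<mu>_def extend_op_alt restrict_eq_iff)
  finally show ?thesis .
qed

lemma heisenberg_supported:
  assumes "finite R" "T \<subseteq> S" "S \<subseteq> R" "supported D R S M"
  shows "supported D R S (heisenberg D R T Ks M)"
proof -
  obtain f where f: "\<And>a b. a\<in>basis_states D R \<Longrightarrow> b\<in>basis_states D R \<Longrightarrow> M a b = extend_op R S f a b"
    using assms(4) unfolding supported_def by blast
  have TR: "T \<subseteq> R" using assms by blast
  let ?B = "basis_states D T"
  define g where "g \<alpha> \<beta> = (\<Sum>K\<leftarrow>Ks. \<Sum>\<gamma>\<in>?B. \<Sum>\<delta>\<in>?B.
    cnj (K \<gamma> (restrict \<alpha> T)) * f (override_on \<alpha> \<gamma> T) (override_on \<beta> \<delta> T) * K \<delta> (restrict \<beta> T))" for \<alpha> \<beta>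
  have r: "restrict (restrict a S) T = restrict a T" for a :: basis_state using assms(2) by (simp add: Int_absorb1)
  have M: "M (override_on a \<gamma> T) (override_on b \<delta> T) = (if \<forall>r\<in>R-S. a r = b r
      then f (override_on (restrict a S) \<gamma> T) (override_on (restrict b S) \<delta> T) else 0)"
    if "a \<in> basis_states D R" "b \<in> basis_states D R" "\<gamma> \<in> ?B" "\<delta> \<in> ?B" for a b \<gamma> \<delta>
  proof -
    have "(\<forall>r\<in>R-S. override_on a \<gamma> T r = override_on b \<delta> T r) \<longleftrightarrow> (\<forall>r\<in>R-S. a r = b r)"
      by (intro ball_cong refl) (use assms(2) in \<open>auto simp: override_on_def\<close>)
    then show ?thesis
      using that assms TR by (simp add: f override_basis_states extend_op_alt restrict_override_subset)
  qed
  have "heisenberg D R T Ks M a b = extend_op R S g a b"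
    if ab: "a \<in> basis_states D R" "b \<in> basis_states D R" for a b
    unfolding heisenberg_local[OF assms(1) TR ab]
  proof (cases "\<forall>r\<in>R-S. a r = b r")
    case True
    then show "(\<Sum>K\<leftarrow>Ks. \<Sum>\<gamma>\<in>?B. \<Sum>\<delta>\<in>?B.
       cnj (K \<gamma> (restrict a T)) * M (override_on a \<gamma> T) (override_on b \<delta> T) * K \<delta> (restrict b T))
       = extend_op R S g a b"
      by (simp add: M ab extend_op_alt g_def r del: restrict_restrict cong: sum.cong)
  next
    case False
    then show "(\<Sum>K\<leftarrow>Ks. \<Sum>\<gamma>\<in>?B. \<Sum>\<delta>\<in>?B.
       cnj (K \<gamma> (restrict a T)) * M (override_on a \<gamma> T) (override_on b \<delta> T) * K \<delta> (restrict b T))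
       = extend_op R S g a b"
      using M[OF ab] by (simp only: extend_op_alt if_False cong: sum.cong) simp
  qed
  then show ?thesis unfolding supported_def by blast
qed

text \<open>Equality of the reduced states on S, phrased by expectations to be dual to
  \<open>supported\<close>. For S = {} it is equality of traces.\<close>

definition same_on :: "(reg \<Rightarrow> nat) \<Rightarrow> reg set \<Rightarrow> reg set \<Rightarrow> operator \<Rightarrow> operator \<Rightarrow> bool" where
  "same_on D R S \<rho> \<sigma> \<longleftrightarrow> (\<forall>M. supported D R S M \<longrightarrow> expect D R M \<rho> = expect D R M \<sigma>)"

text \<open>Operators are functions on all assignments, while only the entries at basis states carry
  meaning; this is equality of those entries.\<close>

definition agree :: "(reg \<Rightarrow> nat) \<Rightarrow> reg set \<Rightarrow> operator \<Rightarrow> operator \<Rightarrow> bool" where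
  "agree D R \<rho> \<sigma> \<longleftrightarrow> (\<forall>a\<in>basis_states D R. \<forall>b\<in>basis_states D R. \<rho> a b = \<sigma> a b)"

lemma expect_cong:
  "agree D R M M' \<Longrightarrow> agree D R \<rho> \<sigma> \<Longrightarrow> expect D R M \<rho> = expect D R M' \<sigma>"
  unfolding expect_def agree_def by (intro sum.cong refl) auto

lemma agree_refl [simp]: "agree D R \<rho> \<rho>"
  and agree_sym: "agree D R \<rho> \<sigma> \<Longrightarrow> agree D R \<sigma> \<rho>"
  and agree_trans [trans]: "agree D R \<rho> \<sigma> \<Longrightarrow> agree D R \<sigma> \<tau> \<Longrightarrow> agree D R \<rho> \<tau>"
  by (auto simp: agree_def)

lemma agree_same_on: "agree D R \<rho> \<sigma> \<Longrightarrow> same_on D R S \<rho> \<sigma>"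
  unfolding same_on_def by (blast intro: expect_cong agree_refl)

lemma same_on_refl [simp]: "same_on D R S \<rho> \<rho>"
  and same_on_trans [trans]: "same_on D R S \<rho> \<sigma> \<Longrightarrow> same_on D R S \<sigma> \<tau> \<Longrightarrow> same_on D R S \<rho> \<tau>"
  by (auto simp: same_on_def)

lemma same_on_mono: "same_on D R T \<rho> \<sigma> \<Longrightarrow> S \<subseteq> T \<Longrightarrow> T \<subseteq> R \<Longrightarrow> same_on D R S \<rho> \<sigma>"
  unfolding same_on_def using supported_mono by blast

text \<open>No-signalling, read off from its dual \<open>heisenberg_disjoint\<close>.\<close>

lemma same_on_disjoint:
  assumes "finite R" "T \<subseteq> R" "S \<inter> T = {}" "S \<subseteq> R" "kraus_operation D T Ks"
  shows "same_on D R S (apply_kraus D R T Ks \<rho>) \<rho>"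
  unfolding same_on_def expect_apply_kraus
  using heisenberg_disjoint[OF assms(1-4) _ assms(5)] by (auto intro!: expect_cong simp: agree_def)

lemma same_on_apply:
  assumes "finite R" "T \<subseteq> S" "S \<subseteq> R" "same_on D R S \<rho> \<sigma>"
  shows "same_on D R S (apply_kraus D R T Ks \<rho>) (apply_kraus D R T Ks \<sigma>)"
  using heisenberg_supported[OF assms(1-3)] assms(4) unfolding same_on_def expect_apply_kraus by blast

section \<open>Linearity, positivity and commutation of operations\<close>

lemma apply_kraus_cong:
  "agree D R \<rho> \<sigma> \<Longrightarrow> apply_kraus D R S Ks \<rho> = apply_kraus D R S Ks \<sigma>"
  unfolding apply_kraus_def agree_def
  by (intro ext arg_cong[of _ _ sum_list] map_cong refl sum.cong) auto

lemma apply_kraus_sum: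
  "apply_kraus D R S Ks (\<lambda>a b. \<Sum>j\<in>J. w j * \<rho> j a b) = (\<lambda>a b. \<Sum>j\<in>J. w j * apply_kraus D R S Ks (\<rho> j) a b)"
proof (intro ext)
  fix a b
  let ?B = "basis_states D R" and ?E = "extend_op R S"
  have "(\<Sum>c\<in>?B. \<Sum>d\<in>?B. ?E K a c * (\<Sum>j\<in>J. w j * \<rho> j c d) * cnj (?E K b d))
      = (\<Sum>j\<in>J. w j * (\<Sum>c\<in>?B. \<Sum>d\<in>?B. ?E K a c * \<rho> j c d * cnj (?E K b d)))" for K
  proof -
    have "(\<Sum>c\<in>?B. \<Sum>d\<in>?B. ?E K a c * (\<Sum>j\<in>J. w j * \<rho> j c d) * cnj (?E K b d))
      = (\<Sum>c\<in>?B. \<Sum>d\<in>?B. \<Sum>j\<in>J. w j * (?E K a c * \<rho> j c d * cnj (?E K b d)))"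
      by (simp add: sum_distrib_left sum_distrib_right mult_ac)
    also have "\<dots> = (\<Sum>c\<in>?B. \<Sum>j\<in>J. \<Sum>d\<in>?B. w j * (?E K a c * \<rho> j c d * cnj (?E K b d)))"
      by (intro sum.cong refl sum.swap)
    also have "\<dots> = (\<Sum>j\<in>J. \<Sum>c\<in>?B. \<Sum>d\<in>?B. w j * (?E K a c * \<rho> j c d * cnj (?E K b d)))"
      by (rule sum.swap)
    finally show ?thesis by (simp only: sum_distrib_left)
  qed
  then show "apply_kraus D R S Ks (\<lambda>a b. \<Sum>j\<in>J. w j * \<rho> j a b) a b
      = (\<Sum>j\<in>J. w j * apply_kraus D R S Ks (\<rho> j) a b)"
    unfolding apply_kraus_def by (induction Ks) (simp_all add: sum.distrib distrib_left)
qed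

lemma expect_sum:
  "expect D R M (\<lambda>a b. \<Sum>j\<in>J. w j * \<rho> j a b) = (\<Sum>j\<in>J. w j * expect D R M (\<rho> j))"
proof -
  let ?B = "basis_states D R"
  have "expect D R M (\<lambda>a b. \<Sum>j\<in>J. w j * \<rho> j a b) = (\<Sum>a\<in>?B. \<Sum>b\<in>?B. \<Sum>j\<in>J. w j * (M a b * \<rho> j b a))"
    by (simp add: expect_def sum_distrib_left mult_ac)
  also have "\<dots> = (\<Sum>a\<in>?B. \<Sum>j\<in>J. \<Sum>b\<in>?B. w j * (M a b * \<rho> j b a))"
    by (intro sum.cong refl sum.swap)
  also have "\<dots> = (\<Sum>j\<in>J. \<Sum>a\<in>?B. \<Sum>b\<in>?B. w j * (M a b * \<rho> j b a))"
    by (rule sum.swap)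
  finally show ?thesis by (simp only: expect_def sum_distrib_left)
qed

lemma psd_apply_kraus:
  "finite R \<Longrightarrow> psd (basis_states D R) \<rho> \<Longrightarrow> psd (basis_states D R) (apply_kraus D R S Ks \<rho>)"
  unfolding apply_kraus_def by (intro psd_sum_list psd_congruence finite_basis_states)

lemma sum_list_sum_swap: "(\<Sum>x\<leftarrow>xs. \<Sum>y\<in>A. f x y) = (\<Sum>y\<in>A. \<Sum>x\<leftarrow>xs. (f x y :: complex))"
  by (induction xs) (simp_all add: sum.distrib)

lemma sum_list_swap: "(\<Sum>x\<leftarrow>xs. \<Sum>y\<leftarrow>ys. f x y) = (\<Sum>y\<leftarrow>ys. \<Sum>x\<leftarrow>xs. (f x y :: complex))"
  by (induction xs) (simp_all add: sum_list_addf)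

lemma apply_kraus_commute:
  assumes "finite R" "S \<subseteq> R" "T \<subseteq> R" "S \<inter> T = {}"
  shows "agree D R (apply_kraus D R S Ks (apply_kraus D R T Ls \<rho>)) (apply_kraus D R T Ls (apply_kraus D R S Ks \<rho>))"
  unfolding agree_def
proof (intro ballI)
  fix a b assume ab: "a \<in> basis_states D R" "b \<in> basis_states D R"
  let ?S = "basis_states D S" and ?T = "basis_states D T"
  have TS: "T \<inter> S = {}" using assms(4) by blast
  \<comment> \<open>The common summand of both orders: overwriting S and overwriting T do not
    interfere, so the orders differ only in the order of summation.\<close>
  define \<Phi> where "\<Phi> K L \<gamma> \<delta> \<alpha> \<beta> = K (restrict a S) \<gamma> * cnj (K (restrict b S) \<delta>) *
    (L (restrict a T) \<alpha> * cnj (L (restrict b T) \<beta>)) *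
    \<rho> (override_on (override_on a \<gamma> S) \<alpha> T) (override_on (override_on b \<delta> S) \<beta> T)" for K L :: operator and \<gamma> \<delta> \<alpha> \<beta>
  have l: "apply_kraus D R S Ks (apply_kraus D R T Ls \<rho>) a b
      = (\<Sum>K\<leftarrow>Ks. \<Sum>\<gamma>\<in>?S. \<Sum>\<delta>\<in>?S. \<Sum>L\<leftarrow>Ls. \<Sum>\<alpha>\<in>?T. \<Sum>\<beta>\<in>?T. \<Phi> K L \<gamma> \<delta> \<alpha> \<beta>)"
    using ab assms
    by (simp add: apply_kraus_local[OF assms(1,2)] apply_kraus_local[OF assms(1,3)] override_basis_states
        restrict_override_disjoint[OF TS] \<Phi>_def sum_list_const_mult[symmetric] sum_list_mult_const[symmetric]
        sum_distrib_left sum_distrib_right mult_ac cong: sum.cong)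
  have r: "apply_kraus D R T Ls (apply_kraus D R S Ks \<rho>) a b
      = (\<Sum>L\<leftarrow>Ls. \<Sum>\<alpha>\<in>?T. \<Sum>\<beta>\<in>?T. \<Sum>K\<leftarrow>Ks. \<Sum>\<gamma>\<in>?S. \<Sum>\<delta>\<in>?S. \<Phi> K L \<gamma> \<delta> \<alpha> \<beta>)"
    using ab assms
    by (simp add: apply_kraus_local[OF assms(1,2)] apply_kraus_local[OF assms(1,3)] override_basis_states
        restrict_override_disjoint[OF assms(4)] override_commute[OF TS] \<Phi>_def sum_list_const_mult[symmetric] sum_list_mult_const[symmetric]
        sum_distrib_left sum_distrib_right mult_ac cong: sum.cong)
  show "apply_kraus D R S Ks (apply_kraus D R T Ls \<rho>) a b = apply_kraus D R T Ls (apply_kraus D R S Ks \<rho>) a b"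
  proof -
    let ?\<Phi> = "\<lambda>K p L q. case p of (\<gamma>, \<delta>) \<Rightarrow> case q of (\<alpha>, \<beta>) \<Rightarrow> \<Phi> K L \<gamma> \<delta> \<alpha> \<beta>"
    have "(\<Sum>K\<leftarrow>Ks. \<Sum>p\<in>?S\<times>?S. \<Sum>L\<leftarrow>Ls. \<Sum>q\<in>?T\<times>?T. ?\<Phi> K p L q)
        = (\<Sum>K\<leftarrow>Ks. \<Sum>L\<leftarrow>Ls. \<Sum>p\<in>?S\<times>?S. \<Sum>q\<in>?T\<times>?T. ?\<Phi> K p L q)"
      unfolding sum_list_sum_swap[of _ _ Ls] ..
    also have "\<dots> = (\<Sum>L\<leftarrow>Ls. \<Sum>K\<leftarrow>Ks. \<Sum>q\<in>?T\<times>?T. \<Sum>p\<in>?S\<times>?S. ?\<Phi> K p L q)"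
      unfolding sum_list_swap[of _ Ls Ks] sum.swap[of _ "?T\<times>?T" "?S\<times>?S"] ..
    also have "\<dots> = (\<Sum>L\<leftarrow>Ls. \<Sum>q\<in>?T\<times>?T. \<Sum>K\<leftarrow>Ks. \<Sum>p\<in>?S\<times>?S. ?\<Phi> K p L q)"
      unfolding sum_list_sum_swap[of _ _ Ks] ..
    finally show ?thesis unfolding l r sum.cartesian_product by (simp only: case_prod_unfold)
  qed
qed

section \<open>Sequences of steps and their causal reordering\<close>

definition run_steps :: "(reg \<Rightarrow> nat) \<Rightarrow> reg set \<Rightarrow> step list \<Rightarrow> operator \<Rightarrow> operator" where
  "run_steps D R ss \<rho> = fold (\<lambda>s. apply_kraus D R (acted s) (kraus s)) ss \<rho>"

lemma run_steps_simps [simp]: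
  "run_steps D R [] \<rho> = \<rho>"
  "run_steps D R (s # ss) \<rho> = run_steps D R ss (apply_kraus D R (acted s) (kraus s) \<rho>)"
  by (simp_all add: run_steps_def)

lemma run_steps_agree: "agree D R \<rho> \<sigma> \<Longrightarrow> agree D R (run_steps D R ss \<rho>) (run_steps D R ss \<sigma>)"
  using apply_kraus_cong[of D R \<rho> \<sigma>] by (cases ss) simp_all

lemma run_steps_sum:
  "run_steps D R ss (\<lambda>a b. \<Sum>j\<in>J. w j * \<rho> j a b) = (\<lambda>a b. \<Sum>j\<in>J. w j * run_steps D R ss (\<rho> j) a b)"
  by (induction ss arbitrary: \<rho>) (simp_all add: apply_kraus_sum)

lemma psd_run_steps:
  "finite R \<Longrightarrow> psd (basis_states D R) \<rho> \<Longrightarrow> psd (basis_states D R) (run_steps D R ss \<rho>)"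
  by (induction ss arbitrary: \<rho>) (simp_all add: psd_apply_kraus)

definition local_steps :: "(reg \<Rightarrow> nat) \<Rightarrow> reg set \<Rightarrow> step list \<Rightarrow> bool" where
  "local_steps D S ss \<longleftrightarrow> (\<forall>s\<in>set ss. acted s \<subseteq> S \<and> kraus_operation D (acted s) (kraus s))"

lemma local_steps_Cons [simp]:
  "local_steps D S (s # ss) \<longleftrightarrow> acted s \<subseteq> S \<and> kraus_operation D (acted s) (kraus s) \<and> local_steps D S ss"
  by (auto simp: local_steps_def)

lemma run_steps_disjoint:
  assumes "finite R" "T \<subseteq> R" "S \<inter> T = {}" "S \<subseteq> R"
  shows "local_steps D T ss \<Longrightarrow> same_on D R S (run_steps D R ss \<rho>) \<rho>"
proof (induction ss arbitrary: \<rho>)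
  case (Cons s ss)
  have "same_on D R S (apply_kraus D R (acted s) (kraus s) \<rho>) \<rho>"
    using Cons.prems assms by (intro same_on_disjoint) auto
  then show ?case using Cons by (auto intro: same_on_trans)
qed simp

lemma run_steps_same_on:
  assumes "finite R" "S \<subseteq> R"
  shows "local_steps D S ss \<Longrightarrow> same_on D R S \<rho> \<sigma> \<Longrightarrow> same_on D R S (run_steps D R ss \<rho>) (run_steps D R ss \<sigma>)"
  by (induction ss arbitrary: \<rho> \<sigma>) (auto intro: same_on_apply[OF assms(1) _ assms(2)])

text \<open>\<open>Q\<close> is to be read as a causal past: no dropped step is followed by a kept
  one on a common register, so its effect never reaches r. The states \<rho> and \<sigma> are
  compared only on r and the registers of the kept steps, because the two runs drift apart elsewhere
  during the induction.\<close>

lemma run_steps_filter: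
  assumes "finite R" "local_steps D R ss" "r \<in> R"
    and "sorted_wrt (\<lambda>s s'. \<not> Q s \<and> Q s' \<longrightarrow> acted s \<inter> acted s' = {}) ss"
    and "\<forall>s\<in>set ss. \<not> Q s \<longrightarrow> r \<notin> acted s"
    and "same_on D R ({r} \<union> (\<Union>s\<in>set (filter Q ss). acted s)) \<rho> \<sigma>"
  shows "same_on D R {r} (run_steps D R ss \<rho>) (run_steps D R (filter Q ss) \<sigma>)"
  using assms(2,4-6)
proof (induction ss arbitrary: \<rho> \<sigma>)
  case (Cons s ss)
  let ?S = "{r} \<union> (\<Union>s\<in>set (filter Q ss). acted s)"
  have sub: "?S \<subseteq> R" using Cons.prems(1) assms(3) by (auto simp: local_steps_def)
  show ?case
  proof (cases "Q s")
    case True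
    have "same_on D R (acted s \<union> ?S) (apply_kraus D R (acted s) (kraus s) \<rho>) (apply_kraus D R (acted s) (kraus s) \<sigma>)"
      using Cons.prems True sub by (intro same_on_apply assms(1)) (auto simp: Un_assoc Un_left_commute)
    then have "same_on D R ?S (apply_kraus D R (acted s) (kraus s) \<rho>) (apply_kraus D R (acted s) (kraus s) \<sigma>)"
      by (rule same_on_mono) (use Cons.prems sub in auto)
    then show ?thesis using Cons True by simp
  next
    case False
    have "same_on D R ?S (apply_kraus D R (acted s) (kraus s) \<rho>) \<rho>"
      using Cons.prems sub False by (intro same_on_disjoint assms(1)) auto
    then have "same_on D R ?S (apply_kraus D R (acted s) (kraus s) \<rho>) \<sigma>"
      using Cons.prems(4) False by (auto intro: same_on_trans)
    then show ?thesis using Cons False by simp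
  qed
qed simp

lemma run_steps_commute:
  assumes "finite R" "S \<subseteq> R" "T \<subseteq> R" "S \<inter> T = {}" "local_steps D T ss"
  shows "agree D R (apply_kraus D R S Ks (run_steps D R ss \<rho>)) (run_steps D R ss (apply_kraus D R S Ks \<rho>))"
  using assms(5)
proof (induction ss arbitrary: \<rho>)
  case (Cons s ss)
  have "agree D R (apply_kraus D R S Ks (apply_kraus D R (acted s) (kraus s) \<rho>))
      (apply_kraus D R (acted s) (kraus s) (apply_kraus D R S Ks \<rho>))"
    using Cons.prems assms by (intro apply_kraus_commute) auto
  from agree_trans[OF Cons.IH run_steps_agree[OF this]] show ?case using Cons.prems by simp
qed simp

text \<open>Nothing is dropped here: a step outside \<open>Q\<close> shares no register with later
  steps in \<open>Q\<close>, so it commutes with them and can be postponed. The entire states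
  agree.\<close>

lemma run_steps_partition:
  assumes "finite R" "local_steps D R ss"
    and "sorted_wrt (\<lambda>s s'. \<not> Q s \<and> Q s' \<longrightarrow> acted s \<inter> acted s' = {}) ss"
  shows "agree D R (run_steps D R ss \<rho>) (run_steps D R (filter (\<lambda>s. \<not> Q s) ss) (run_steps D R (filter Q ss) \<rho>))"
  using assms(2,3)
proof (induction ss arbitrary: \<rho>)
  case (Cons s ss)
  have ls: "local_steps D R ss"
    and sw: "sorted_wrt (\<lambda>s s'. \<not> Q s \<and> Q s' \<longrightarrow> acted s \<inter> acted s' = {}) ss"
    using Cons.prems by simp_all
  note IH = Cons.IH[OF ls sw]
  show ?case
  proof (cases "Q s")
    case False
    have "agree D R (apply_kraus D R (acted s) (kraus s) (run_steps D R (filter Q ss) \<rho>))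
       (run_steps D R (filter Q ss) (apply_kraus D R (acted s) (kraus s) \<rho>))"
    proof (rule run_steps_commute[OF assms(1)])
      show "acted s \<subseteq> R" using Cons.prems(1) by simp
      show "(\<Union>s\<in>set (filter Q ss). acted s) \<subseteq> R" using Cons.prems(1) by (auto simp: local_steps_def)
      show "acted s \<inter> (\<Union>s\<in>set (filter Q ss). acted s) = {}" using Cons.prems(2) False by auto
      show "local_steps D (\<Union>s\<in>set (filter Q ss). acted s) (filter Q ss)"
        using Cons.prems(1) by (auto simp: local_steps_def)
    qed
    then have "agree D R (run_steps D R (filter (\<lambda>s. \<not> Q s) ss) (run_steps D R (filter Q ss) (apply_kraus D R (acted s) (kraus s) \<rho>)))
      (run_steps D R (filter (\<lambda>s. \<not> Q s) ss) (apply_kraus D R (acted s) (kraus s) (run_steps D R (filter Q ss) \<rho>)))"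
      by (rule run_steps_agree[OF agree_sym])
    from agree_trans[OF IH this] show ?thesis using False by simp
  qed (simp add: IH)
qed simp

subsection \<open>Measuring and resetting registers\<close>

definition outcome_op :: "reg \<Rightarrow> (nat \<Rightarrow> bool) \<Rightarrow> operator" where
  "outcome_op r \<phi> = (\<lambda>a b. if a = b \<and> \<phi> (a r) then 1 else 0)"

lemma expect_outcome_op:
  assumes "finite R"
  shows "expect D R (outcome_op r \<phi>) \<rho> = (\<Sum>a | a \<in> basis_states D R \<and> \<phi> (a r). \<rho> a a)"
proof -
  have "expect D R (outcome_op r \<phi>) \<rho> = (\<Sum>a\<in>basis_states D R. \<Sum>b\<in>basis_states D R. if a = b then (if \<phi> (a r) then \<rho> a a else 0) else 0)"
    unfolding expect_def outcome_op_def by (intro sum.cong refl) auto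
  also have "\<dots> = (\<Sum>a\<in>basis_states D R. if \<phi> (a r) then \<rho> a a else 0)"
    using finite_basis_states[OF assms] by simp
  finally show ?thesis using finite_basis_states[OF assms] by (simp add: sum.inter_filter)
qed

lemma supported_outcome_op:
  assumes "r \<in> R"
  shows "supported D R {r} (outcome_op r \<phi>)"
proof -
  have "outcome_op r \<phi> a b = extend_op R {r} (\<lambda>\<alpha> \<beta>. if \<alpha> r = \<beta> r \<and> \<phi> (\<alpha> r) then 1 else 0) a b"
    if "a \<in> basis_states D R" "b \<in> basis_states D R" for a b
  proof -
    have "a = b \<longleftrightarrow> (\<forall>s\<in>R - {r}. a s = b s) \<and> a r = b r"
      using basis_states_eqI[OF that] by blast
    then show ?thesis by (auto simp: outcome_op_def extend_op_alt)
  qed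
  then show ?thesis unfolding supported_def by blast
qed

text \<open>The outcome that always occurs is the identity operator, and its expectation is the
  trace.\<close>

lemma supported_trace: "supported D R {} (outcome_op r (\<lambda>_. True))"
proof -
  have "outcome_op r (\<lambda>_. True) a b = extend_op R {} (\<lambda>\<alpha> \<beta>. 1) a b"
    if "a \<in> basis_states D R" "b \<in> basis_states D R" for a b
    using basis_states_eqI[OF that] by (auto simp: outcome_op_def extend_op_alt)
  then show ?thesis unfolding supported_def by blast
qed

lemma expect_outcome_split:
  "expect D R (outcome_op r \<phi>) \<rho> + expect D R (outcome_op r (\<lambda>x. \<not> \<phi> x)) \<rho> = expect D R (outcome_op r (\<lambda>_. True)) \<rho>"
  unfolding expect_def sum.distrib[symmetric] outcome_op_def by (intro sum.cong refl) auto

lemma expect_outcome_nonneg: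
  assumes "finite R" "psd (basis_states D R) \<rho>"
  shows "0 \<le> expect D R (outcome_op r \<phi>) \<rho>"
  unfolding expect_outcome_op[OF assms(1)]
  using psd_diag[OF assms(2) finite_basis_states[OF assms(1)]] by (intro sum_nonneg) simp

lemma sum_outcomes:
  assumes "finite (basis_states D {r})" "\<alpha> \<in> basis_states D {r}"
  shows "(\<Sum>\<gamma>\<in>basis_states D {r}. (if \<gamma> = \<alpha> \<and> \<phi> (\<gamma> r) then 1 else 0) * f \<gamma>) = (if \<phi> (\<alpha> r) then f \<alpha> else (0::complex))"
proof -
  have "(\<Sum>\<gamma>\<in>basis_states D {r}. (if \<gamma> = \<alpha> \<and> \<phi> (\<gamma> r) then 1 else 0) * f \<gamma>)
      = (\<Sum>\<gamma>\<in>basis_states D {r}. if \<gamma> = \<alpha> then (if \<phi> (\<alpha> r) then f \<alpha> else 0) else 0)"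
    by (intro sum.cong refl) auto
  then show ?thesis using assms by simp
qed

lemma apply_outcome_op:
  assumes "finite R" "r \<in> R" "a \<in> basis_states D R" "b \<in> basis_states D R"
  shows "apply_kraus D R {r} [outcome_op r \<phi>] \<rho> a b = (if \<phi> (a r) \<and> \<phi> (b r) then \<rho> a b else 0)"
proof -
  let ?B = "basis_states D {r}"
  have sub: "{r} \<subseteq> R" using assms by simp
  have ra: "restrict a {r} \<in> ?B" "restrict b {r} \<in> ?B" using restrict_basis_states assms by blast+
  have fin: "finite ?B" by (simp add: finite_basis_states)
  have o: "override_on c (restrict c {r}) {r} = c" for c :: basis_state by (auto simp: override_on_def)
  have "apply_kraus D R {r} [outcome_op r \<phi>] \<rho> a b =
     (\<Sum>\<gamma>\<in>?B. (if \<gamma> = restrict a {r} \<and> \<phi> (\<gamma> r) then 1 else 0) *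
       (\<Sum>\<delta>\<in>?B. (if \<delta> = restrict b {r} \<and> \<phi> (\<delta> r) then 1 else 0) * \<rho> (override_on a \<gamma> {r}) (override_on b \<delta> {r})))"
    unfolding apply_kraus_local[OF assms(1) sub assms(3,4)]
    by (auto simp: outcome_op_def sum_distrib_left intro!: sum.cong)
  also have "\<dots> = (if \<phi> (a r) \<and> \<phi> (b r) then \<rho> a b else 0)"
    unfolding sum_outcomes[OF fin ra(2), of \<phi>] sum_outcomes[OF fin ra(1), of \<phi>]
    by (simp add: o)
  finally show ?thesis .
qed

lemma kraus_outcome:
  "kraus_operation D {r} [outcome_op r \<phi>, outcome_op r (\<lambda>x. \<not> \<phi> x)]"
  unfolding kraus_operation_def
proof (intro ballI)
  fix a b assume ab: "a \<in> basis_states D {r}" "b \<in> basis_states D {r}"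
  let ?B = "basis_states D {r}"
  have "(\<Sum>c\<in>?B. cnj (outcome_op r \<psi> c a) * outcome_op r \<psi> c b) = (if \<psi> (a r) then if a = b then 1 else 0 else 0)" for \<psi>
  proof -
    have "(\<Sum>c\<in>?B. cnj (outcome_op r \<psi> c a) * outcome_op r \<psi> c b) =
      (\<Sum>\<gamma>\<in>?B. (if \<gamma> = a \<and> \<psi> (\<gamma> r) then 1 else 0) * (if \<gamma> = b \<and> \<psi> (\<gamma> r) then 1 else 0))"
      by (intro sum.cong refl) (auto simp: outcome_op_def)
    also have "\<dots> = (if \<psi> (a r) then if a = b \<and> \<psi> (a r) then 1 else 0 else 0)"
      by (rule sum_outcomes) (use ab finite_basis_states[of "{r}"] in auto)
    finally show ?thesis by auto
  qed
  then show "(\<Sum>K\<leftarrow>[outcome_op r \<phi>, outcome_op r (\<lambda>x. \<not> \<phi> x)]. \<Sum>c\<in>?B. cnj (K c a) * K c b) = (if a = b then 1 else 0)"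
    by simp
qed

text \<open>Discarding Y and preparing \<nu> afresh. The formula for states identifies the result;
  the dual formula shows that every observable becomes the identity on Y.\<close>

lemma reset_operation:
  assumes "finite R" "Y \<subseteq> R" "psd (basis_states D Y) \<nu>" "(\<Sum>\<alpha>\<in>basis_states D Y. \<nu> \<alpha> \<alpha>) = 1"
  obtains Ks where "kraus_operation D Y Ks"
    "\<And>\<rho> a b. a \<in> basis_states D R \<Longrightarrow> b \<in> basis_states D R \<Longrightarrow> apply_kraus D R Y Ks \<rho> a b
      = \<nu> (restrict a Y) (restrict b Y) * (\<Sum>m\<in>basis_states D Y. \<rho> (override_on a m Y) (override_on b m Y))"
    "\<And>M a b. a \<in> basis_states D R \<Longrightarrow> b \<in> basis_states D R \<Longrightarrow> heisenberg D R Y Ks M a b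
      = (if restrict a Y = restrict b Y then
           \<Sum>\<gamma>\<in>basis_states D Y. \<Sum>\<delta>\<in>basis_states D Y. \<nu> \<delta> \<gamma> * M (override_on a \<gamma> Y) (override_on b \<delta> Y) else 0)"
proof -
  let ?B = "basis_states D Y"
  have finB: "finite ?B" using finite_basis_states finite_subset[OF assms(2,1)] by blast
  obtain n :: nat and V where V: "\<And>a b. a\<in>?B \<Longrightarrow> b\<in>?B \<Longrightarrow> \<nu> a b = (\<Sum>k<n. V k a * cnj (V k b))"
    using psd_gram[OF finB assms(3)] by metis
  obtain ms where ms: "set ms = ?B" "distinct ms" using finite_distinct_list[OF finB] by blast
  \<comment> \<open>The operator |V k><m| reads the old content m of Y and writes the k-th Gram
    vector of \<nu>.\<close>
  define E :: "nat \<Rightarrow> basis_state \<Rightarrow> operator" where "E k m = (\<lambda>\<alpha> \<beta>. if \<beta> = m then V k \<alpha> else 0)" for k m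
  define Ks where "Ks = map (\<lambda>(k, m). E k m) (List.product [0..<n] ms)"
  have Ks: "(\<Sum>K\<leftarrow>Ks. F K) = (\<Sum>k<n. \<Sum>m\<in>?B. F (E k m))" for F :: "operator \<Rightarrow> complex"
    unfolding Ks_def using ms
    by (simp add: o_def case_prod_unfold sum.distinct_set_conv_list[symmetric] distinct_product
        sum.cartesian_product' lessThan_atLeast0)
  show ?thesis
  proof
    show "kraus_operation D Y Ks"
      unfolding kraus_operation_def Ks E_def
    proof (intro ballI)
      fix a b assume ab: "a \<in> ?B" "b \<in> ?B"
      have "(\<Sum>k<n. \<Sum>m\<in>?B. \<Sum>c\<in>?B. cnj (if a = m then V k c else 0) * (if b = m then V k c else 0))
         = (\<Sum>k<n. \<Sum>m\<in>?B. if a = m then (if a = b then \<Sum>c\<in>?B. V k c * cnj (V k c) else 0) else 0)"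
        by (intro sum.cong refl) (auto simp: mult.commute)
      also have "\<dots> = (if a = b then \<Sum>k<n. \<Sum>c\<in>?B. V k c * cnj (V k c) else 0)"
        using ab finB by simp
      also have "(\<Sum>k<n. \<Sum>c\<in>?B. V k c * cnj (V k c)) = (\<Sum>c\<in>?B. \<Sum>k<n. V k c * cnj (V k c))" by (rule sum.swap)
      also have "\<dots> = (\<Sum>c\<in>?B. \<nu> c c)" by (intro sum.cong refl) (simp add: V)
      finally show "(\<Sum>k<n. \<Sum>m\<in>?B. \<Sum>c\<in>?B. cnj (if a = m then V k c else 0) * (if b = m then V k c else 0))
         = (if a = b then 1 else 0)" by (simp only: assms(4))
    qed
  next
    fix \<rho> a b assume ab: "a \<in> basis_states D R" "b \<in> basis_states D R"
    have r: "restrict a Y \<in> ?B" "restrict b Y \<in> ?B" using restrict_basis_states ab assms(2) by blast+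
    have "apply_kraus D R Y Ks \<rho> a b = (\<Sum>k<n. \<Sum>m\<in>?B. \<Sum>\<gamma>\<in>?B. if \<gamma> = m then
       (\<Sum>\<delta>\<in>?B. if \<delta> = m then V k (restrict a Y) * \<rho> (override_on a m Y) (override_on b m Y) * cnj (V k (restrict b Y)) else 0) else 0)"
      unfolding apply_kraus_local[OF assms(1,2) ab] Ks E_def
      by (intro sum.cong refl) (auto intro!: sum.neutral sum.cong)
    also have "\<dots> = (\<Sum>k<n. \<Sum>m\<in>?B. V k (restrict a Y) * \<rho> (override_on a m Y) (override_on b m Y) * cnj (V k (restrict b Y)))"
      using finB by (intro sum.cong refl) simp
    also have "\<dots> = \<nu> (restrict a Y) (restrict b Y) * (\<Sum>m\<in>?B. \<rho> (override_on a m Y) (override_on b m Y))"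
      unfolding V[OF r] sum_product by (simp add: mult_ac)
    finally show "apply_kraus D R Y Ks \<rho> a b = \<dots>" .
  next
    fix M a b assume ab: "a \<in> basis_states D R" "b \<in> basis_states D R"
    have r: "restrict a Y \<in> ?B" "restrict b Y \<in> ?B" using restrict_basis_states ab assms(2) by blast+
    define W where "W k \<gamma> \<delta> = cnj (V k \<gamma>) * M (override_on a \<gamma> Y) (override_on b \<delta> Y) * V k \<delta>" for k \<gamma> \<delta>
    have "heisenberg D R Y Ks M a b = (\<Sum>k<n. \<Sum>m\<in>?B. if restrict a Y = m then
        (if restrict a Y = restrict b Y then \<Sum>\<gamma>\<in>?B. \<Sum>\<delta>\<in>?B. W k \<gamma> \<delta> else 0) else 0)"
      unfolding heisenberg_local[OF assms(1,2) ab] Ks E_def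
      by (intro sum.cong refl) (auto simp: W_def)
    also have "\<dots> = (if restrict a Y = restrict b Y then \<Sum>k<n. \<Sum>\<gamma>\<in>?B. \<Sum>\<delta>\<in>?B. W k \<gamma> \<delta> else 0)"
      using finB r by simp
    also have "(\<Sum>k<n. \<Sum>\<gamma>\<in>?B. \<Sum>\<delta>\<in>?B. W k \<gamma> \<delta>) = (\<Sum>\<gamma>\<in>?B. \<Sum>k<n. \<Sum>\<delta>\<in>?B. W k \<gamma> \<delta>)"
      by (rule sum.swap)
    also have "\<dots> = (\<Sum>\<gamma>\<in>?B. \<Sum>\<delta>\<in>?B. \<Sum>k<n. W k \<gamma> \<delta>)"
      by (intro sum.cong refl sum.swap)
    also have "\<dots> = (\<Sum>\<gamma>\<in>?B. \<Sum>\<delta>\<in>?B. \<nu> \<delta> \<gamma> * M (override_on a \<gamma> Y) (override_on b \<delta> Y))"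
      by (intro sum.cong refl) (simp add: V W_def sum_distrib_left sum_distrib_right mult_ac)
    finally show "heisenberg D R Y Ks M a b = (if restrict a Y = restrict b Y then
           \<Sum>\<gamma>\<in>?B. \<Sum>\<delta>\<in>?B. \<nu> \<delta> \<gamma> * M (override_on a \<gamma> Y) (override_on b \<delta> Y) else 0)" .
  qed
qed

text \<open>The part of the observable on Y is averaged against \<nu>, which leaves only its action
  on S - Y.\<close>

lemma supported_discarded:
  assumes "finite R" "Y \<subseteq> R" "S \<subseteq> R" "supported D R S M"
  shows "supported D R (S - Y) (\<lambda>a b. if restrict a Y = restrict b Y then
     \<Sum>\<gamma>\<in>basis_states D Y. \<Sum>\<delta>\<in>basis_states D Y. \<nu> \<delta> \<gamma> * M (override_on a \<gamma> Y) (override_on b \<delta> Y) else 0)"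
proof -
  obtain f where f: "\<And>a b. a\<in>basis_states D R \<Longrightarrow> b\<in>basis_states D R \<Longrightarrow> M a b = extend_op R S f a b"
    using assms(4) unfolding supported_def by blast
  let ?B = "basis_states D Y"
  \<comment> \<open>On Y - S the observable is the identity, hence the condition that \<gamma> and
    \<delta> agree there; on S \<inter> Y their values are inserted into f.\<close>
  define g where "g \<alpha> \<beta> = (\<Sum>\<gamma>\<in>?B. \<Sum>\<delta>\<in>?B. \<nu> \<delta> \<gamma> * (if \<forall>r\<in>Y-S. \<gamma> r = \<delta> r
     then f (override_on \<alpha> \<gamma> (S \<inter> Y)) (override_on \<beta> \<delta> (S \<inter> Y)) else 0))" for \<alpha> \<beta>
  have res: "restrict (override_on a \<gamma> Y) S = override_on (restrict a (S - Y)) \<gamma> (S \<inter> Y)" for a \<gamma> :: basis_state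
    by (auto simp: fun_eq_iff override_on_def)
  have "(if restrict a Y = restrict b Y then
     \<Sum>\<gamma>\<in>?B. \<Sum>\<delta>\<in>?B. \<nu> \<delta> \<gamma> * M (override_on a \<gamma> Y) (override_on b \<delta> Y) else 0) = extend_op R (S - Y) g a b"
    if ab: "a \<in> basis_states D R" "b \<in> basis_states D R" for a b
  proof -
    have M: "M (override_on a \<gamma> Y) (override_on b \<delta> Y) = (if \<forall>r\<in>R-(S\<union>Y). a r = b r then if \<forall>r\<in>Y-S. \<gamma> r = \<delta> r
      then f (override_on (restrict a (S - Y)) \<gamma> (S \<inter> Y)) (override_on (restrict b (S - Y)) \<delta> (S \<inter> Y)) else 0 else 0)"
      if "\<gamma> \<in> ?B" "\<delta> \<in> ?B" for \<gamma> \<delta>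
    proof -
      have "(\<forall>r\<in>R-S. override_on a \<gamma> Y r = override_on b \<delta> Y r) \<longleftrightarrow>
          (\<forall>r\<in>R-(S\<union>Y). a r = b r) \<and> (\<forall>r\<in>Y-S. \<gamma> r = \<delta> r)"
        using assms(2) by (auto simp: override_on_def)
      then show ?thesis
        using ab that by (simp add: f override_basis_states[OF _ _ assms(2)] extend_op_alt res)
    qed
    have iff: "(\<forall>r\<in>R-(S-Y). a r = b r) \<longleftrightarrow> (\<forall>r\<in>R-(S\<union>Y). a r = b r) \<and> restrict a Y = restrict b Y"
      using assms(2) by (auto simp: restrict_eq_iff)
    show ?thesis
    proof (cases "\<forall>r\<in>R-(S\<union>Y). a r = b r")
      case True
      then show ?thesis unfolding extend_op_alt iff g_def using M by (simp cong: sum.cong)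
    next
      case False
      then have "M (override_on a \<gamma> Y) (override_on b \<delta> Y) = 0" if "\<gamma> \<in> ?B" "\<delta> \<in> ?B" for \<gamma> \<delta>
        using M[OF that] by (simp only: if_False)
      then show ?thesis using False unfolding extend_op_alt iff by auto
    qed
  qed
  then show ?thesis unfolding supported_def by blast
qed

subsection \<open>Product states\<close>

lemma sum_basis_states_Un:
  assumes "S \<inter> U = {}"
  shows "(\<Sum>a\<in>basis_states D (S \<union> U). f (restrict a S) * g (restrict a U))
       = (\<Sum>\<alpha>\<in>basis_states D S. f \<alpha>) * (\<Sum>\<beta>\<in>basis_states D U. g \<beta> :: complex)"
  unfolding sum_product sum.cartesian_product
proof (rule sum.reindex_bij_witness[where j = "\<lambda>a. (restrict a S, restrict a U)" and i = "\<lambda>(\<alpha>, \<beta>). override_on \<beta> \<alpha> S"])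
  fix a assume a: "a \<in> basis_states D (S \<union> U)"
  then show "(case (restrict a S, restrict a U) of (\<alpha>, \<beta>) \<Rightarrow> override_on \<beta> \<alpha> S) = a"
    by (auto simp: basis_states_def PiE_iff extensional_def override_on_def fun_eq_iff)
  show "(restrict a S, restrict a U) \<in> basis_states D S \<times> basis_states D U"
    using restrict_basis_states[OF a] by simp
next
  fix p assume "p \<in> basis_states D S \<times> basis_states D U"
  then obtain \<alpha> \<beta> where p: "p = (\<alpha>, \<beta>)" "\<alpha> \<in> basis_states D S" "\<beta> \<in> basis_states D U" by blast
  then show "(case p of (\<alpha>, \<beta>) \<Rightarrow> override_on \<beta> \<alpha> S) \<in> basis_states D (S \<union> U)"
    by (auto simp: basis_states_def PiE_iff extensional_def override_on_def)
  have "restrict (override_on \<beta> \<alpha> S) U = \<beta>"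
    using p(3) assms by (simp add: restrict_override_disjoint Int_commute restrict_basis_states_id)
  then show "(restrict (case p of (\<alpha>, \<beta>) \<Rightarrow> override_on \<beta> \<alpha> S) S, restrict (case p of (\<alpha>, \<beta>) \<Rightarrow> override_on \<beta> \<alpha> S) U) = p"
    using p restrict_override_same by simp
qed simp

text \<open>Fubini over the blocks. With diagonal entries for g it says that the trace of a product
  state is the product of the traces.\<close>

lemma sum_prod_blocks:
  fixes g :: "reg set \<Rightarrow> basis_state \<Rightarrow> complex"
  assumes "finite P" "disjoint P"
  shows "(\<Sum>a\<in>basis_states D (\<Union>P). \<Prod>S\<in>P. g S (restrict a S)) = (\<Prod>S\<in>P. \<Sum>\<alpha>\<in>basis_states D S. g S \<alpha>)"
  using assms
proof (induction P rule: finite_induct)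
  case empty
  then show ?case by (simp add: basis_states_def)
next
  case (insert S P)
  have disj: "S \<inter> \<Union>P = {}"
    using insert.hyps(2) insert.prems by (auto simp: disjoint_def)
  have disjP: "disjoint P" using insert.prems by (auto simp: disjoint_def)
  have "(\<Sum>a\<in>basis_states D (\<Union>(insert S P)). \<Prod>T\<in>insert S P. g T (restrict a T))
      = (\<Sum>a\<in>basis_states D (S \<union> \<Union>P). g S (restrict a S) * (\<Prod>T\<in>P. g T (restrict (restrict a (\<Union>P)) T)))"
    using insert.hyps by (simp add: Int_absorb1 Union_upper cong: prod.cong)
  also have "\<dots> = (\<Sum>\<alpha>\<in>basis_states D S. g S \<alpha>) * (\<Sum>\<beta>\<in>basis_states D (\<Union>P). \<Prod>T\<in>P. g T (restrict \<beta> T))"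
    by (rule sum_basis_states_Un[OF disj])
  also have "\<dots> = (\<Prod>S\<in>insert S P. \<Sum>\<alpha>\<in>basis_states D S. g S \<alpha>)"
    unfolding insert.IH[OF disjP] using insert.hyps by simp
  finally show ?case .
qed

lemma supported_cong: "supported D R S M \<Longrightarrow> agree D R M' M \<Longrightarrow> supported D R S M'"
  unfolding supported_def agree_def by auto

lemma density_psd: "density D S \<rho> \<Longrightarrow> psd (basis_states D S) \<rho>"
  unfolding density_def psd_def less_eq_complex_def by (simp add: complex_is_Real_iff)

lemma density_trace: "density D S \<rho> \<Longrightarrow> (\<Sum>a\<in>basis_states D S. \<rho> a a) = 1"
  unfolding density_def by blast

lemma sum_basis_states_single: "(\<Sum>\<alpha>\<in>basis_states D {r}. f (\<alpha> r)) = (\<Sum>i<D r. f i)"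
  by (rule sum.reindex_bij_witness[where i = "\<lambda>i. (\<lambda>_. undefined)(r := i)" and j = "\<lambda>\<alpha>. \<alpha> r"])
    (auto simp: basis_states_def PiE_iff extensional_def fun_eq_iff)

definition block_product :: "reg set set \<Rightarrow> (reg set \<Rightarrow> operator) \<Rightarrow> operator" where
  "block_product P \<tau> = (\<lambda>a b. \<Prod>S\<in>P. \<tau> S (restrict a S) (restrict b S))"

lemma psd_block_product:
  assumes "finite R" "finite P" "\<And>S. S \<in> P \<Longrightarrow> S \<subseteq> R" "\<And>S. S \<in> P \<Longrightarrow> psd (basis_states D S) (\<tau> S)"
  shows "psd (basis_states D R) (block_product P \<tau>)"
  unfolding block_product_def
proof (intro psd_prod finite_basis_states assms(1,2))
  fix S assume "S \<in> P"
  then show "psd (basis_states D R) (\<lambda>a b. \<tau> S (restrict a S) (restrict b S))"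
    using psd_pullback[where \<kappa> = "\<tau> S" and g = "\<lambda>a. restrict a S" and J = "basis_states D S" and I = "basis_states D R"]
      assms(1,3,4) finite_subset finite_basis_states restrict_basis_states by metis
qed

text \<open>For \<kappa> that ignores \<open>Qubit\<close> this is q \<otimes> \<kappa>. The factor
  q is an arbitrary kernel, not only a state, since the bound is obtained by linearity from the
  identity and from a difference of projectors.\<close>

definition with_qubit :: "(nat \<Rightarrow> nat \<Rightarrow> complex) \<Rightarrow> operator \<Rightarrow> operator" where
  "with_qubit q \<kappa> = (\<lambda>a b. q (a Qubit) (b Qubit) * \<kappa> a b)"

text \<open>Tracing out the blocks \<open>PY\<close> of a product contributes the factor 1 and
  leaves the remaining factors untouched, so only the preparation of the new blocks is visible. One
  operation serves all q, hence it can be applied without knowing the qubit.\<close>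

lemma block_product_reset:
  assumes "finite R" "finite P" "disjoint P" "\<Union>P \<subseteq> R" "PY \<subseteq> P" "Qubit \<notin> \<Union>PY"
    and psd: "\<And>S. S \<in> PY \<Longrightarrow> psd (basis_states D S) (\<tau>1 S)"
    and tr: "\<And>S. S \<in> PY \<Longrightarrow> (\<Sum>a\<in>basis_states D S. \<tau>0 S a a) = 1" "\<And>S. S \<in> PY \<Longrightarrow> (\<Sum>a\<in>basis_states D S. \<tau>1 S a a) = 1"
    and eq: "\<And>S. S \<in> P - PY \<Longrightarrow> \<tau>0 S = \<tau>1 S"
  obtains Ks where "kraus_operation D (\<Union>PY) Ks"
    "\<And>q. agree D R (apply_kraus D R (\<Union>PY) Ks (with_qubit q (block_product P \<tau>0))) (with_qubit q (block_product P \<tau>1))"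
    "\<And>S M. S \<subseteq> R \<Longrightarrow> supported D R S M \<Longrightarrow> supported D R (S - \<Union>PY) (heisenberg D R (\<Union>PY) Ks M)"
proof -
  let ?Y = "\<Union>PY"
  have fPY: "finite PY" "disjoint PY" using assms(2,3,5) finite_subset by (auto simp: disjoint_def)
  have Y: "?Y \<subseteq> R" using assms(4,5) by blast
  have trY: "(\<Sum>\<alpha>\<in>basis_states D ?Y. block_product PY \<tau> \<alpha> \<alpha>) = 1"
    if "\<And>S. S \<in> PY \<Longrightarrow> (\<Sum>a\<in>basis_states D S. \<tau> S a a) = 1" for \<tau>
    unfolding block_product_def sum_prod_blocks[OF fPY, of "\<lambda>S a. \<tau> S a a"] using that by simp
  have trY0: "(\<Sum>\<alpha>\<in>basis_states D ?Y. block_product PY \<tau>0 \<alpha> \<alpha>) = 1" by (rule trY) (rule tr(1))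
  have trY1: "(\<Sum>\<alpha>\<in>basis_states D ?Y. block_product PY \<tau>1 \<alpha> \<alpha>) = 1" by (rule trY) (rule tr(2))
  have psdY: "psd (basis_states D ?Y) (block_product PY \<tau>1)"
    using Y assms(1) by (intro psd_block_product fPY psd finite_subset[of ?Y R]) auto
  obtain Ks where Ks: "kraus_operation D ?Y Ks"
    "\<And>\<rho> a b. a \<in> basis_states D R \<Longrightarrow> b \<in> basis_states D R \<Longrightarrow> apply_kraus D R ?Y Ks \<rho> a b
      = block_product PY \<tau>1 (restrict a ?Y) (restrict b ?Y) * (\<Sum>m\<in>basis_states D ?Y. \<rho> (override_on a m ?Y) (override_on b m ?Y))"
    "\<And>M a b. a \<in> basis_states D R \<Longrightarrow> b \<in> basis_states D R \<Longrightarrow> heisenberg D R ?Y Ks M a b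
      = (if restrict a ?Y = restrict b ?Y then
           \<Sum>\<gamma>\<in>basis_states D ?Y. \<Sum>\<delta>\<in>basis_states D ?Y. block_product PY \<tau>1 \<delta> \<gamma> * M (override_on a \<gamma> ?Y) (override_on b \<delta> ?Y) else 0)"
    by (rule reset_operation[OF assms(1) Y psdY trY1], rule that)
  show ?thesis
  proof
    show "kraus_operation D ?Y Ks" by (rule Ks(1))
    show "supported D R (S - ?Y) (heisenberg D R ?Y Ks M)" if "S \<subseteq> R" "supported D R S M" for S M
      by (rule supported_cong[OF supported_discarded[OF assms(1) Y that, where \<nu> = "block_product PY \<tau>1"]]) (simp add: agree_def Ks(3))
    show "agree D R (apply_kraus D R ?Y Ks (with_qubit q (block_product P \<tau>0))) (with_qubit q (block_product P \<tau>1))" for q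
      unfolding agree_def
    proof (intro ballI)
      fix a b assume ab: "a \<in> basis_states D R" "b \<in> basis_states D R"
      have split: "block_product P \<tau> c d = block_product (P - PY) \<tau> c d * block_product PY \<tau> c d" for \<tau> c d
        unfolding block_product_def by (rule prod.subset_diff[OF assms(5,2)])
      have Yrestr: "block_product PY \<tau> (restrict c ?Y) (restrict d ?Y) = block_product PY \<tau> c d" for \<tau> c d
        unfolding block_product_def by (intro prod.cong refl) (simp add: Int_absorb1 Union_upper)
      have outside: "block_product (P - PY) \<tau>0 (override_on a m ?Y) (override_on b m ?Y) = block_product (P - PY) \<tau>1 a b" for m
        unfolding block_product_def
      proof (intro prod.cong refl)
        fix S assume S: "S \<in> P - PY"
        then have "S \<inter> ?Y = {}" using assms(3,5) by (fastforce simp: disjoint_def)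
        then show "\<tau>0 S (restrict (override_on a m ?Y) S) (restrict (override_on b m ?Y) S) = \<tau>1 S (restrict a S) (restrict b S)"
          using eq[OF S] by (simp add: restrict_override_disjoint)
      qed
      have inside: "block_product PY \<tau>0 (override_on a m ?Y) (override_on b m ?Y) = block_product PY \<tau>0 m m"
        if "m \<in> basis_states D ?Y" for m
        using Yrestr[of \<tau>0 "override_on a m ?Y" "override_on b m ?Y"] that by (simp add: restrict_override_same)
      have "(\<Sum>m\<in>basis_states D ?Y. with_qubit q (block_product P \<tau>0) (override_on a m ?Y) (override_on b m ?Y))
        = (\<Sum>m\<in>basis_states D ?Y. q (a Qubit) (b Qubit) * block_product (P - PY) \<tau>1 a b * block_product PY \<tau>0 m m)"
      proof (intro sum.cong refl)
        fix m assume "m \<in> basis_states D ?Y"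
        then show "with_qubit q (block_product P \<tau>0) (override_on a m ?Y) (override_on b m ?Y)
           = q (a Qubit) (b Qubit) * block_product (P - PY) \<tau>1 a b * block_product PY \<tau>0 m m"
          using assms(6) unfolding with_qubit_def split[of \<tau>0] outside by (simp add: inside)
      qed
      also have "\<dots> = q (a Qubit) (b Qubit) * block_product (P - PY) \<tau>1 a b"
        unfolding sum_distrib_left[symmetric] trY0 by simp
      finally show "apply_kraus D R ?Y Ks (with_qubit q (block_product P \<tau>0)) a b = with_qubit q (block_product P \<tau>1) a b"
        unfolding Ks(2)[OF ab] Yrestr with_qubit_def split[of \<tau>1] by (simp add: mult_ac)
    qed
  qed
qed

definition basis_block :: "nat \<Rightarrow> (reg set \<Rightarrow> operator) \<Rightarrow> reg set \<Rightarrow> operator" where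
  "basis_block \<theta> \<tau> = \<tau>({Basis} := \<lambda>a b. if a Basis = \<theta> \<and> b Basis = \<theta> then 1 else 0)"

lemma psd_basis_block:
  assumes "\<And>S. S \<in> P \<Longrightarrow> density D S (\<tau> S)" "S \<in> insert {Basis} P"
  shows "psd (basis_states D S) (basis_block \<theta> \<tau> S)"
proof (cases "S = {Basis}")
  case True
  show ?thesis unfolding basis_block_def True
    by (rule psd_of_gram[where K = "{()}" and V = "\<lambda>_ a. if a Basis = \<theta> then 1 else 0"]) auto
qed (use assms in \<open>auto simp: basis_block_def density_psd\<close>)

lemma trace_basis_block:
  assumes "\<And>S. S \<in> P \<Longrightarrow> density D S (\<tau> S)" "S \<in> insert {Basis} P" "\<theta> < D Basis"
  shows "(\<Sum>a\<in>basis_states D S. basis_block \<theta> \<tau> S a a) = 1"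
proof (cases "S = {Basis}")
  case True
  show ?thesis unfolding basis_block_def True
    using assms(3) sum_basis_states_single[where f = "\<lambda>i. if i = \<theta> then 1 else (0::complex)" and D = D and r = Basis] by simp
qed (use assms in \<open>auto simp: basis_block_def density_trace\<close>)

text \<open>The block product is constant in \<open>Qubit\<close>, so that register contributes its
  dimension: the kernel is the identity on the qubit times a state.\<close>

lemma trace_qubit_block_product:
  assumes "finite P" "disjoint (insert {Qubit} P)" "{Qubit} \<notin> P" "\<And>S. S \<in> P \<Longrightarrow> (\<Sum>a\<in>basis_states D S. \<tau> S a a) = 1"
  shows "(\<Sum>a\<in>basis_states D (insert Qubit (\<Union>P)). block_product P \<tau> a a) = of_nat (D Qubit)"
proof -
  \<comment> \<open>The weight 1 turns \<open>Qubit\<close> into one more block.\<close>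
  let ?g = "\<lambda>S. if S = {Qubit} then \<lambda>_. 1 else (\<lambda>a. \<tau> S a a)"
  have "(\<Sum>a\<in>basis_states D (insert Qubit (\<Union>P)). block_product P \<tau> a a)
      = (\<Sum>a\<in>basis_states D (\<Union>(insert {Qubit} P)). \<Prod>S\<in>insert {Qubit} P. ?g S (restrict a S))"
    using assms(1,3) by (auto simp: block_product_def intro!: sum.cong prod.cong)
  also have "\<dots> = (\<Prod>S\<in>insert {Qubit} P. \<Sum>\<alpha>\<in>basis_states D S. ?g S \<alpha>)"
    by (rule sum_prod_blocks) (use assms in auto)
  also have "\<dots> = (\<Sum>\<alpha>\<in>basis_states D {Qubit}. 1) * (\<Prod>S\<in>P. 1)"
  proof -
    have "(\<Prod>S\<in>P. \<Sum>\<alpha>\<in>basis_states D S. ?g S \<alpha>) = (\<Prod>S\<in>P. 1)"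
      using assms(3,4) by (intro prod.cong refl) auto
    then show ?thesis using assms(1,3) by simp
  qed
  also have "\<dots> = of_nat (D Qubit)"
    using sum_basis_states_single[where f = "\<lambda>_. 1 :: complex" and D = D and r = Qubit] by simp
  finally show ?thesis .
qed

subsection \<open>The joint measurement\<close>

text \<open>
  The operator is positive already for the constant \<open>1 + 1 / sqrt 2\<close> in place of \<open>7/4\<close>, which would
  give the optimal bound \<open>1/2 + 1 / sqrt 8\<close>; the rational constant is good enough here.
\<close>

lemma psd_guess:
  assumes "x \<in> {0,1}" "y \<in> {0,1}"
  shows "psd {0,1} (\<lambda>v w. 7/4 * (if v = w then 1 else 0)
     - bb84_state 0 x v * cnj (bb84_state 0 x w) - bb84_state 1 y v * cnj (bb84_state 1 y w))"
proof (rule psd_of_gram[where K = "{0,1::nat}" and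
      V = "\<lambda>k v. if k = 0 then if v = x then 1/2 else - ((-1) ^ y) else if v = x then 0 else 1/2"])
  \<comment> \<open>The vectors are Cholesky columns with pivot x: the diagonal entry there is 7/4 -
    1 - 1/2 = 1/4, the off-diagonal entry is -(-1)^y / 2, and the Schur complement is 5/4 - 1 =
    1/4.\<close>
  fix v w :: nat assume "v \<in> {0,1}" "w \<in> {0,1}"
  then show "7/4 * (if v = w then 1 else 0)
     - bb84_state 0 x v * cnj (bb84_state 0 x w) - bb84_state 1 y v * cnj (bb84_state 1 y w)
    = (\<Sum>k\<in>{0,1::nat}. (if k = 0 then if v = x then 1/2 else - ((-1) ^ y) else if v = x then 0 else 1/2) *
        cnj (if k = 0 then if w = x then 1/2 else - ((-1) ^ y) else if w = x then 0 else 1/2))"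
    using assms
    by (auto simp: bb84_state_def hadamard_def simp flip: of_real_mult)
qed

text \<open>All answers other than \<open>0\<close> count as a guess of \<open>1\<close>, so that the two outcomes are complementary.\<close>

definition guess :: "nat \<Rightarrow> nat \<Rightarrow> bool" where
  "guess x v \<longleftrightarrow> (v = 0) = (x = 0)"

definition bb84_projector :: "nat \<Rightarrow> nat \<Rightarrow> nat \<Rightarrow> nat \<Rightarrow> complex" where
  "bb84_projector x \<theta> = (\<lambda>v w. bb84_state \<theta> x v * cnj (bb84_state \<theta> x w))"

text \<open>
  For \<open>\<theta> = 0\<close> only the answer \<open>r0\<close> is checked and for \<open>\<theta> = 1\<close> only the answer \<open>r1\<close>.  Resetting the
  registers \<open>Y\<close>, through which alone \<open>As\<close> can influence \<open>r1\<close>, allows both answers to be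
  obtained from the same qubit.
\<close>

lemma joint_measurement_bound:
  assumes R: "finite R" "Qubit \<in> R" "D Qubit = 2" "r0 \<in> R" "r1 \<in> R"
    and Y: "Y \<subseteq> R"
    and L: "local_steps D (R - Y) L" and As: "local_steps D R As" and Bs: "local_steps D R Bs"
    and indep: "({r0} \<union> (\<Union>s\<in>set As. acted s)) \<inter> (({r1} \<union> (\<Union>s\<in>set Bs. acted s)) - Y) = {}"
    and reset: "kraus_operation D Y Ks"
      "\<And>q. agree D R (apply_kraus D R Y Ks (with_qubit q \<kappa>0)) (with_qubit q \<kappa>1)"
      "\<And>S M. S \<subseteq> R \<Longrightarrow> supported D R S M \<Longrightarrow> supported D R (S - Y) (heisenberg D R Y Ks M)"
    and psd: "psd (basis_states D R) \<kappa>0"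
    and tr: "(\<Sum>a\<in>basis_states D R. \<kappa>0 a a) = 2"
  shows "(\<Sum>x\<in>{0,1}. expect D R (outcome_op r0 (guess x)) (run_steps D R As (run_steps D R L (with_qubit (bb84_projector x 0) \<kappa>0))))
    + (\<Sum>y\<in>{0,1}. expect D R (outcome_op r1 (guess y)) (run_steps D R Bs (run_steps D R L (with_qubit (bb84_projector y 1) \<kappa>1)))) \<le> 7/2"
proof -
  let ?T = "outcome_op r1 (\<lambda>_. True)"
  define pr where "pr x \<rho> = apply_kraus D R {r0} [outcome_op r0 (guess x)] \<rho>" for x \<rho>
  define rs where "rs \<rho> = run_steps D R Bs (apply_kraus D R Y Ks \<rho>)" for \<rho>
  \<comment> \<open>On \<open>with_qubit q \<kappa>0\<close> this plays the role of the trace of G x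
    y times q: the guess x at r0 is recorded, then Y is reset and the guess y at r1 is read.
    Linearity and positivity of \<open>N\<close> are what the matrix inequality acts on.\<close>
  define N where "N x y \<rho> = expect D R (outcome_op r1 (guess y)) (rs (pr x (run_steps D R As (run_steps D R L \<rho>))))" for x y \<rho>
  have guess1: "guess 1 = (\<lambda>v. \<not> guess 0 v)" by (simp add: guess_def fun_eq_iff)
  have N_sum: "N x y (\<lambda>a b. \<Sum>j\<in>J. w j * \<rho> j a b) = (\<Sum>j\<in>J. w j * N x y (\<rho> j))" for x y and J :: "nat set" and w \<rho>
    unfolding N_def rs_def pr_def run_steps_sum apply_kraus_sum expect_sum ..
  have N_nonneg: "0 \<le> N x y \<rho>" if "psd (basis_states D R) \<rho>" for x y \<rho>
    unfolding N_def rs_def pr_def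
    by (intro expect_outcome_nonneg R psd_run_steps psd_apply_kraus that)
  have trace_Bs: "same_on D R {} (rs \<rho>) \<rho>" for \<rho>
    unfolding rs_def using run_steps_disjoint[OF R(1) _ _ _ Bs, of "{}"] same_on_disjoint[OF R(1) Y _ _ reset(1), of "{}"]
    by (auto intro: same_on_trans)
  \<comment> \<open>The second reading comes later and preserves the trace, so it does not disturb
    the first.\<close>
  have marginal0: "N x 0 \<rho> + N x 1 \<rho> = expect D R (outcome_op r0 (guess x)) (run_steps D R As (run_steps D R L \<rho>))" for x \<rho>
  proof -
    let ?\<sigma> = "run_steps D R As (run_steps D R L \<rho>)"
    have "N x 0 \<rho> + N x 1 \<rho> = expect D R ?T (rs (pr x ?\<sigma>))"
      unfolding N_def guess1 by (rule expect_outcome_split)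
    also have "\<dots> = expect D R ?T (pr x ?\<sigma>)"
      using trace_Bs supported_trace unfolding same_on_def by blast
    also have "\<dots> = expect D R (outcome_op r0 (guess x)) ?\<sigma>"
      unfolding expect_outcome_op[OF R(1)] pr_def
      using finite_basis_states[OF R(1), of D]
      by (simp add: apply_outcome_op[OF R(1,4)] sum.inter_filter cong: sum.cong)
    finally show ?thesis .
  qed
  \<comment> \<open>Summed over x, the reading of r0 is an operation. On the registers that matter
    for r1, this reading and \<open>As\<close> act only within Y, where the reset erases them. The
    reset in turn commutes with \<open>L\<close> and changes \<kappa>0 to \<kappa>1.\<close>
  have marginal1: "N 0 y (with_qubit q \<kappa>0) + N 1 y (with_qubit q \<kappa>0)
      = expect D R (outcome_op r1 (guess y)) (run_steps D R Bs (run_steps D R L (with_qubit q \<kappa>1)))" for y q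
  proof -
    let ?SB = "{r1} \<union> (\<Union>s\<in>set Bs. acted s)"
    let ?L = "run_steps D R L (with_qubit q \<kappa>0)"
    let ?m = "apply_kraus D R {r0} [outcome_op r0 (guess 0), outcome_op r0 (guess 1)] (run_steps D R As ?L)"
    have SB: "?SB \<subseteq> R" using R(5) Bs by (auto simp: local_steps_def)
    have m: "?m = (\<lambda>a b. \<Sum>x\<in>{0,1::nat}. 1 * pr x (run_steps D R As ?L) a b)"
      by (simp add: pr_def apply_kraus_def fun_eq_iff)
    have "N 0 y (with_qubit q \<kappa>0) + N 1 y (with_qubit q \<kappa>0) = expect D R (outcome_op r1 (guess y)) (rs ?m)"
      unfolding m rs_def run_steps_sum apply_kraus_sum expect_sum by (simp add: N_def rs_def)
    also have "same_on D R ?SB (rs ?m) (run_steps D R Bs (run_steps D R L (with_qubit q \<kappa>1)))"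
    proof -
      have "same_on D R (?SB - Y) ?m (run_steps D R As ?L)"
        unfolding guess1 by (rule same_on_disjoint[OF R(1) _ _ _ kraus_outcome]) (use R(4) SB indep in auto)
      also have "same_on D R (?SB - Y) (run_steps D R As ?L) ?L"
        by (rule run_steps_disjoint[OF R(1), of "\<Union>s\<in>set As. acted s"])
          (use As SB indep in \<open>auto simp: local_steps_def\<close>)
      finally have "same_on D R ?SB (apply_kraus D R Y Ks ?m) (apply_kraus D R Y Ks ?L)"
        unfolding same_on_def expect_apply_kraus using reset(3)[OF SB] by blast
      also have "same_on D R ?SB (apply_kraus D R Y Ks ?L) (run_steps D R L (apply_kraus D R Y Ks (with_qubit q \<kappa>0)))"
        by (intro agree_same_on run_steps_commute[OF R(1) Y _ _ L]) auto
      also have "same_on D R ?SB (run_steps D R L (apply_kraus D R Y Ks (with_qubit q \<kappa>0))) (run_steps D R L (with_qubit q \<kappa>1))"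
        by (intro agree_same_on run_steps_agree reset(2))
      finally show ?thesis
        unfolding rs_def by (rule run_steps_same_on[OF R(1) SB, rotated]) (use Bs in \<open>auto simp: local_steps_def\<close>)
    qed
    then have "expect D R (outcome_op r1 (guess y)) (rs ?m)
      = expect D R (outcome_op r1 (guess y)) (run_steps D R Bs (run_steps D R L (with_qubit q \<kappa>1)))"
      using supported_mono[OF supported_outcome_op[OF R(5)] _ SB] unfolding same_on_def by blast
    finally show ?thesis .
  qed
  define I :: "nat \<Rightarrow> nat \<Rightarrow> complex" where "I v w = (if v = w then 1 else 0)" for v w
  have bound: "N x y (with_qubit (bb84_projector x 0) \<kappa>0) + N x y (with_qubit (bb84_projector y 1) \<kappa>0)
      \<le> 7/4 * N x y (with_qubit I \<kappa>0)" if "x \<in> {0,1}" "y \<in> {0,1}" for x y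
  proof -
    define q where "q = (\<lambda>v w. 7/4 * I v w - bb84_projector x 0 v w - bb84_projector y 1 v w)"
    have "psd {0,1} q" using psd_guess[OF that] unfolding q_def I_def bb84_projector_def .
    then have "psd (basis_states D R) (\<lambda>a b. q (a Qubit) (b Qubit))"
      by (rule psd_pullback) (use R in \<open>auto simp: basis_states_def PiE_iff less_2_cases_iff\<close>)
    then have "0 \<le> N x y (with_qubit q \<kappa>0)"
      unfolding with_qubit_def by (intro N_nonneg psd_schur_product finite_basis_states R psd)
    also have "with_qubit q \<kappa>0 = (\<lambda>a b. \<Sum>j\<in>{0,1,2::nat}. (if j = 0 then 7/4 else - 1) *
        with_qubit (if j = 0 then I else if j = 1 then bb84_projector x 0 else bb84_projector y 1) \<kappa>0 a b)"
      by (simp add: with_qubit_def q_def fun_eq_iff algebra_simps)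
    also have "N x y \<dots> = 7/4 * N x y (with_qubit I \<kappa>0) - N x y (with_qubit (bb84_projector x 0) \<kappa>0)
        - N x y (with_qubit (bb84_projector y 1) \<kappa>0)"
      unfolding N_sum by simp
    finally show ?thesis by (simp add: algebra_simps less_eq_complex_def)
  qed
  \<comment> \<open>The four outcomes are exhaustive, so they add up to the trace of the identity on
    the qubit times a state; this gives 7/4 * 2 in the end.\<close>
  have total: "N 0 0 (with_qubit I \<kappa>0) + N 0 1 (with_qubit I \<kappa>0) + (N 1 0 (with_qubit I \<kappa>0) + N 1 1 (with_qubit I \<kappa>0)) = 2"
  proof -
    let ?L = "run_steps D R L (with_qubit I \<kappa>0)"
    let ?T0 = "outcome_op r0 (\<lambda>_. True)"
    have "N 0 0 (with_qubit I \<kappa>0) + N 0 1 (with_qubit I \<kappa>0) + (N 1 0 (with_qubit I \<kappa>0) + N 1 1 (with_qubit I \<kappa>0))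
      = expect D R ?T0 (run_steps D R As ?L)"
      unfolding marginal0 unfolding guess1 by (rule expect_outcome_split)
    also have "same_on D R {} (run_steps D R As ?L) ?L"
      using run_steps_disjoint[OF R(1) _ _ _ As, of "{}"] by simp
    then have "expect D R ?T0 (run_steps D R As ?L) = expect D R ?T0 ?L"
      using supported_trace unfolding same_on_def by blast
    also have "same_on D R {} ?L (with_qubit I \<kappa>0)"
      using run_steps_disjoint[OF R(1) _ _ _ L, of "{}"] by auto
    then have "expect D R ?T0 ?L = expect D R ?T0 (with_qubit I \<kappa>0)"
      using supported_trace unfolding same_on_def by blast
    also have "\<dots> = 2" unfolding expect_outcome_op[OF R(1)] using tr by (simp add: with_qubit_def I_def)
    finally show ?thesis .
  qed
  have "(\<Sum>x\<in>{0,1}. expect D R (outcome_op r0 (guess x)) (run_steps D R As (run_steps D R L (with_qubit (bb84_projector x 0) \<kappa>0))))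
    + (\<Sum>y\<in>{0,1}. expect D R (outcome_op r1 (guess y)) (run_steps D R Bs (run_steps D R L (with_qubit (bb84_projector y 1) \<kappa>1))))
    = (\<Sum>x\<in>{0,1}. \<Sum>y\<in>{0,1}. N x y (with_qubit (bb84_projector x 0) \<kappa>0) + N x y (with_qubit (bb84_projector y 1) \<kappa>0))"
    unfolding marginal0[symmetric] marginal1[symmetric] by simp
  also have "\<dots> \<le> (\<Sum>x\<in>{0,1}. \<Sum>y\<in>{0,1}. 7/4 * N x y (with_qubit I \<kappa>0))"
    by (intro sum_mono bound)
  also have "\<dots> = 7/4 * (N 0 0 (with_qubit I \<kappa>0) + N 0 1 (with_qubit I \<kappa>0) + (N 1 0 (with_qubit I \<kappa>0) + N 1 1 (with_qubit I \<kappa>0)))"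
    by (simp add: algebra_simps)
  also have "\<dots> = 7/2" unfolding total by simp
  finally show ?thesis .
qed

subsection \<open>Causality\<close>

text \<open>
  The origin is the arrival of the messages at the claimed position, and \<open>u\<close> increases towards
  \<open>V\<^sub>0\<close>, \<open>v\<close> towards \<open>V\<^sub>1\<close>; the sign \<open>\<sigma>\<close> covers both orders of the verifiers on the line.
\<close>

lemma light_cone_coordinates:
  assumes "claimed g \<in> convex hull {pos0 g, pos1 g}"
  obtains u v :: "event \<Rightarrow> real" where
    "\<And>e f. reaches e f \<longleftrightarrow> u e \<le> u f \<and> v e \<le> v f"
    "\<And>e. fst e \<noteq> claimed g \<Longrightarrow> u e \<noteq> v e"
    "\<And>e p. reaches (reception g p) e \<Longrightarrow> 0 \<le> u e \<or> 0 \<le> v e"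
    "u (emission0 g) = 0" "v (emission1 g) = 0"
    "v (deadline0 g) = 0" "0 \<le> u (deadline0 g)"
    "u (deadline1 g) = 0" "0 \<le> v (deadline1 g)"
proof -
  define \<sigma> :: real where "\<sigma> = (if pos0 g \<le> pos1 g then 1 else -1)"
  have \<sigma>: "\<sigma> = 1 \<or> \<sigma> = -1" by (simp add: \<sigma>_def)
  have "claimed g \<in> closed_segment (pos0 g) (pos1 g)" using assms by (simp add: segment_convex_hull)
  then have between: "\<sigma> * pos0 g \<le> \<sigma> * claimed g" "\<sigma> * claimed g \<le> \<sigma> * pos1 g"
    by (auto simp: \<sigma>_def closed_segment_eq_real_ivl split: if_splits)
  have d: "dist (pos0 g) (claimed g) = \<sigma> * claimed g - \<sigma> * pos0 g" "dist (pos1 g) (claimed g) = \<sigma> * pos1 g - \<sigma> * claimed g"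
    using between \<sigma> by (auto simp: dist_real_def)
  define u v :: "event \<Rightarrow> real" where
    "u e = snd e - arrival g - \<sigma> * (fst e - claimed g)" and
    "v e = snd e - arrival g + \<sigma> * (fst e - claimed g)" for e
  have reach: "reaches e f \<longleftrightarrow> u e \<le> u f \<and> v e \<le> v f" for e f
    using \<sigma> by (auto simp: reaches_def u_def v_def dist_real_def abs_le_iff algebra_simps)
  have e: "u (emission0 g) = 0" "v (emission1 g) = 0"
    by (simp_all add: u_def v_def emission0_def emission1_def d algebra_simps)
  show ?thesis
  proof
    show "reaches e f \<longleftrightarrow> u e \<le> u f \<and> v e \<le> v f" for e f by (rule reach)
    \<comment> \<open>The difference u e - v e is -2 * \<sigma> * (fst e - claimed g).\<close>
    show "u e \<noteq> v e" if "fst e \<noteq> claimed g" for e using that \<sigma> by (auto simp: u_def v_def)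
    show "0 \<le> u e \<or> 0 \<le> v e" if "reaches (reception g p) e" for e p
    proof -
      have "reaches (emission0 g) (reception g p) \<or> reaches (emission1 g) (reception g p)"
        by (auto simp: reaches_def reception_def emission0_def emission1_def min_def)
      then show ?thesis using that e by (auto simp: reach)
    qed
    show "u (emission0 g) = 0" "v (emission1 g) = 0" by (rule e)+
    show "v (deadline0 g) = 0" "0 \<le> u (deadline0 g)" "u (deadline1 g) = 0" "0 \<le> v (deadline1 g)"
      using between by (simp_all add: u_def v_def deadline0_def deadline1_def d algebra_simps)
  qed
qed

text \<open>Steps outside the past \<open>Q\<close> of an answer are discarded and those in
  \<open>L\<close> are moved to the front. The same \<open>L\<close> for both answers gives the two
  runs a common beginning, from which one joint measurement can be built.\<close>

lemma run_steps_answer: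
  assumes "finite R" "local_steps D R ss" "r \<in> R"
    and Q: "sorted_wrt (\<lambda>s s'. \<not> Q s \<and> Q s' \<longrightarrow> acted s \<inter> acted s' = {}) ss"
    and L: "sorted_wrt (\<lambda>s s'. \<not> L s \<and> L s' \<longrightarrow> acted s \<inter> acted s' = {}) ss"
    and "\<forall>s\<in>set ss. \<not> Q s \<longrightarrow> r \<notin> acted s" "\<And>s. L s \<Longrightarrow> Q s"
  shows "same_on D R {r} (run_steps D R ss \<rho>) (run_steps D R (filter (\<lambda>s. Q s \<and> \<not> L s) ss) (run_steps D R (filter L ss) \<rho>))"
proof -
  have "same_on D R {r} (run_steps D R ss \<rho>) (run_steps D R (filter Q ss) \<rho>)"
    using assms by (intro run_steps_filter) auto
  also have "agree D R (run_steps D R (filter Q ss) \<rho>)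
      (run_steps D R (filter (\<lambda>s. \<not> L s) (filter Q ss)) (run_steps D R (filter L (filter Q ss)) \<rho>))"
    using assms(1,2) L by (intro run_steps_partition sorted_wrt_filter) (auto simp: local_steps_def)
  then have "same_on D R {r} (run_steps D R (filter Q ss) \<rho>)
      (run_steps D R (filter (\<lambda>s. \<not> L s) (filter Q ss)) (run_steps D R (filter L (filter Q ss)) \<rho>))"
    by (rule agree_same_on)
  also have "filter L (filter Q ss) = filter L ss"
    using assms(7) by (auto intro: filter_cong)
  finally show ?thesis by simp
qed

section \<open>Reduction of an attack to the joint measurement\<close>

definition both_answers :: "coalition \<Rightarrow> nat \<Rightarrow> operator \<Rightarrow> complex" where
  "both_answers C x \<rho> = (\<Sum>a | a \<in> basis_states (dimension C) (registers C) \<and> a (answer0 C) = x \<and> a (answer1 C) = x. \<rho> a a)"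

text \<open>Diagonal entries of a positive kernel are nonnegative, so dropping one check and
  weakening the other from equality to \<open>guess\<close> only adds to the sum.\<close>

lemma both_answers_le:
  assumes "finite (registers C)" "psd (basis_states (dimension C) (registers C)) \<rho>"
  shows "both_answers C x \<rho> \<le> expect (dimension C) (registers C) (outcome_op (answer0 C) (guess x)) \<rho>"
    and "both_answers C x \<rho> \<le> expect (dimension C) (registers C) (outcome_op (answer1 C) (guess x)) \<rho>"
proof -
  note fin = finite_basis_states[OF assms(1), of "dimension C"]
  show "both_answers C x \<rho> \<le> expect (dimension C) (registers C) (outcome_op (answer0 C) (guess x)) \<rho>"
    unfolding both_answers_def expect_outcome_op[OF assms(1)]
    by (rule sum_mono2) (use fin psd_diag[OF assms(2) fin] in \<open>auto simp: guess_def\<close>)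
  show "both_answers C x \<rho> \<le> expect (dimension C) (registers C) (outcome_op (answer1 C) (guess x)) \<rho>"
    unfolding both_answers_def expect_outcome_op[OF assms(1)]
    by (rule sum_mono2) (use fin psd_diag[OF assms(2) fin] in \<open>auto simp: guess_def\<close>)
qed

lemma memory_blocks_facts:
  assumes "no_PE_coalition g C"
  shows "finite (memory_blocks C)" "disjoint (memory_blocks C)" "\<Union>(memory_blocks C) = memory C"
    "Qubit \<notin> memory C" "Basis \<notin> memory C"
proof -
  have m: "finite (memory C)" "memory C \<subseteq> (\<Union>i<num_provers C. range (Held i)) \<union> range Early"
    using assms unfolding no_PE_coalition_def by blast+
  show "finite (memory_blocks C)"
    by (rule finite_subset[of _ "Pow (memory C)"]) (use m(1) in \<open>auto simp: memory_blocks_def\<close>)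
  show "disjoint (memory_blocks C)" by (auto simp: disjoint_def memory_blocks_def)
  show "\<Union>(memory_blocks C) = memory C"
  proof
    show "memory C \<subseteq> \<Union>(memory_blocks C)"
    proof
      fix r assume r: "r \<in> memory C"
      then consider i k where "i < num_provers C" "r = Held i k" | k where "r = Early k" using m(2) by blast
      then show "r \<in> \<Union>(memory_blocks C)"
        using r by cases (auto simp: memory_blocks_def)
    qed
  qed (auto simp: memory_blocks_def)
  show "Qubit \<notin> memory C" "Basis \<notin> memory C" using m(2) by auto
qed

text \<open>This is the case of one term of the separable decomposition: the blocks are in a product
  state, so some can be reset without affecting the others.\<close>

lemma product_attack_bound:
  fixes \<tau> :: "reg set \<Rightarrow> operator"
  assumes hull: "claimed g \<in> convex hull {pos0 g, pos1 g}" and C: "no_PE_coalition g C"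
    and in_time: "in_time g C (answer0 C) (deadline0 g)" "in_time g C (answer1 C) (deadline1 g)"
    and \<tau>: "\<And>S. S \<in> memory_blocks C \<Longrightarrow> density (dimension C) S (\<tau> S)"
  defines "\<kappa> \<equiv> \<lambda>\<theta>. block_product (insert {Basis} (memory_blocks C)) (basis_block \<theta> \<tau>)"
  shows "(\<Sum>x\<in>{0,1}. \<Sum>\<theta>\<in>{0,1}. both_answers C x
      (run_steps (dimension C) (registers C) (steps C) (with_qubit (bb84_projector x \<theta>) (\<kappa> \<theta>)))) \<le> 7/2"
proof -
  let ?D = "dimension C" and ?R = "registers C" and ?ss = "steps C" and ?P = "memory_blocks C"
  note P = memory_blocks_facts[OF C]
  have finR: "finite ?R" using C by (simp add: registers_def no_PE_coalition_def)
  have D2: "?D Qubit = 2" "?D Basis = 2" using C by (auto simp: no_PE_coalition_def)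
  have r: "answer0 C \<in> ?R" "answer1 C \<in> ?R" "answer0 C \<noteq> answer1 C" "Qubit \<in> ?R"
    using C by (auto simp: no_PE_coalition_def registers_def)
  have ls: "local_steps ?D ?R ?ss" using C by (auto simp: no_PE_coalition_def local_steps_def)
  have avail: "available g C r (step_event C s)" if "s \<in> set ?ss" "r \<in> acted s" for r s
    using C that by (auto simp: no_PE_coalition_def)
  obtain u v :: "event \<Rightarrow> real" where reach: "\<And>e f. reaches e f \<longleftrightarrow> u e \<le> u f \<and> v e \<le> v f"
    and off: "\<And>e. fst e \<noteq> claimed g \<Longrightarrow> u e \<noteq> v e"
    and after: "\<And>e p. reaches (reception g p) e \<Longrightarrow> 0 \<le> u e \<or> 0 \<le> v e"
    and E: "u (emission0 g) = 0" "v (emission1 g) = 0"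
    and dl: "v (deadline0 g) = 0" "0 \<le> u (deadline0 g)" "u (deadline1 g) = 0" "0 \<le> v (deadline1 g)"
    using light_cone_coordinates[OF hull] by blast
  define us where "us s = u (step_event C s)" for s
  define vs where "vs s = v (step_event C s)" for s
  have step: "0 \<le> us s \<or> 0 \<le> vs s" "us s \<noteq> vs s" if "s \<in> set ?ss" for s
  proof -
    have "reaches (reception g (location C (actor s))) (step_event C s)" "location C (actor s) \<noteq> claimed g"
      using C that by (auto simp: no_PE_coalition_def)
    then show "0 \<le> us s \<or> 0 \<le> vs s" "us s \<noteq> vs s"
      using after off[of "step_event C s"] by (auto simp: us_def vs_def step_event_def)
  qed
  have order: "us (?ss ! k) \<le> us (?ss ! l) \<and> vs (?ss ! k) \<le> vs (?ss ! l)"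
    if "k < l" "l < length ?ss" "acted (?ss ! k) \<inter> acted (?ss ! l) \<noteq> {}" for k l
    using C that unfolding no_PE_coalition_def reach us_def vs_def by blast
  have comparable: "us s \<le> us s' \<and> vs s \<le> vs s' \<or> us s' \<le> us s \<and> vs s' \<le> vs s"
    if s: "s \<in> set ?ss" "s' \<in> set ?ss" "r \<in> acted s" "r \<in> acted s'" for s s' r
  proof -
    obtain k l where kl: "k < length ?ss" "s = ?ss ! k" "l < length ?ss" "s' = ?ss ! l"
      using s(1,2) by (auto simp: in_set_conv_nth)
    then consider "k < l" | "k = l" | "l < k" by linarith
    then show ?thesis using order[of k l] order[of l k] kl s(3,4) by cases auto
  qed
  \<comment> \<open>The steps \<open>L\<close> reach both deadlines and cannot know \<open>\<theta>\<close>.  Any other step that reaches both deadlines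
    has \<open>u < 0\<close>, so it cannot have met the qubit (fact \<open>notL\<close>).\<close>
  define L where "L s \<longleftrightarrow> us s \<le> 0 \<and> vs s < 0" for s
  \<comment> \<open>\<open>QA\<close> and \<open>QB\<close> are the pasts of the two deadlines, with
    v (deadline0 g) = 0 and u (deadline1 g) = 0 inserted. Both are closed under going back in time,
    which yields the sorting conditions.\<close>
  define QA where "QA s \<longleftrightarrow> us s \<le> u (deadline0 g) \<and> vs s \<le> 0" for s
  define QB where "QB s \<longleftrightarrow> us s \<le> 0 \<and> vs s \<le> v (deadline1 g)" for s
  have sorted: "sorted_wrt (\<lambda>s s'. \<not> Q s \<and> Q s' \<longrightarrow> acted s \<inter> acted s' = {}) ?ss"
    if "\<And>s s'. us s \<le> us s' \<Longrightarrow> vs s \<le> vs s' \<Longrightarrow> Q s' \<Longrightarrow> Q s" for Q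
    unfolding sorted_wrt_iff_nth_less using order that by blast
  have sortL: "sorted_wrt (\<lambda>s s'. \<not> L s \<and> L s' \<longrightarrow> acted s \<inter> acted s' = {}) ?ss"
    by (rule sorted) (auto simp: L_def)
  have ansA: "same_on ?D ?R {answer0 C} (run_steps ?D ?R ?ss \<rho>)
      (run_steps ?D ?R (filter (\<lambda>s. QA s \<and> \<not> L s) ?ss) (run_steps ?D ?R (filter L ?ss) \<rho>))" for \<rho>
  proof (rule run_steps_answer[OF finR ls r(1) _ sortL])
    show "sorted_wrt (\<lambda>s s'. \<not> QA s \<and> QA s' \<longrightarrow> acted s \<inter> acted s' = {}) ?ss"
      by (rule sorted) (auto simp: QA_def)
    show "\<forall>s\<in>set ?ss. \<not> QA s \<longrightarrow> answer0 C \<notin> acted s"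
      using in_time(1) dl by (auto simp: in_time_def reach QA_def us_def vs_def)
    show "QA s" if "L s" for s using that dl by (auto simp: L_def QA_def)
  qed
  have ansB: "same_on ?D ?R {answer1 C} (run_steps ?D ?R ?ss \<rho>)
      (run_steps ?D ?R (filter (\<lambda>s. QB s \<and> \<not> L s) ?ss) (run_steps ?D ?R (filter L ?ss) \<rho>))" for \<rho>
  proof (rule run_steps_answer[OF finR ls r(2) _ sortL])
    show "sorted_wrt (\<lambda>s s'. \<not> QB s \<and> QB s' \<longrightarrow> acted s \<inter> acted s' = {}) ?ss"
      by (rule sorted) (auto simp: QB_def)
    show "\<forall>s\<in>set ?ss. \<not> QB s \<longrightarrow> answer1 C \<notin> acted s"
      using in_time(2) dl by (auto simp: in_time_def reach QB_def us_def vs_def)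
    show "QB s" if "L s" for s using that dl by (auto simp: L_def QB_def)
  qed
  \<comment> \<open>Blocks met by \<open>L\<close> stay with the qubit; \<open>Basis\<close> and all
    other blocks are the ones to be prepared anew.\<close>
  define PX where "PX = {S\<in>?P. \<exists>s\<in>set ?ss. L s \<and> acted s \<inter> S \<noteq> {}}"
  define PY where "PY = insert {Basis} (?P - PX)"
  have notL: "r \<noteq> Qubit \<and> (\<forall>S\<in>PX. r \<notin> S)"
    if s: "s \<in> set ?ss" "QA s" "QB s" "\<not> L s" "r \<in> acted s" for s r
  proof -
    \<comment> \<open>Here u and v are at most 0, and outside \<open>L\<close> this forces v = 0;
      then u = 0 is impossible because no prover is at the claimed position.\<close>
    have us: "us s < 0" and vs: "vs s = 0" using s(2-4) step[OF s(1)] by (auto simp: QA_def QB_def L_def)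
    have "r \<noteq> Qubit" using avail[OF s(1,5)] us E by (auto simp: reach us_def)
    moreover have False if S: "S \<in> PX" "r \<in> S" for S
    proof -
      obtain l r' where l: "l \<in> set ?ss" "L l" "r' \<in> acted l" "r' \<in> S" using S(1) unfolding PX_def by blast
      have "S \<in> ?P" using S(1) by (simp add: PX_def)
      then consider i where "S = memory C \<inter> range (Held i)" | k where "S = {Early k}"
        by (auto simp: memory_blocks_def)
      then show False
      proof cases
        \<comment> \<open>Held memory leaves its prover only after a reception there. That reception
          would precede s, where u < 0, and l, where v < 0, so neither verifier's message could have
          arrived.\<close>
        case (1 i)
        let ?rec = "reception g (location C i)"
        have "reaches ?rec (step_event C s)" "reaches ?rec (step_event C l)"
          using avail[OF s(1,5)] avail[OF l(1,3)] S(2) l(4) 1 by auto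
        then have "u ?rec < 0" "v ?rec < 0" using us l(2) by (auto simp: reach us_def vs_def L_def)
        moreover have "reaches ?rec ?rec" by (simp add: reach)
        ultimately show False using after[of "location C i" ?rec] by linarith
      next
        \<comment> \<open>A single register is touched by both steps, so s and l are causally
          ordered; but u is larger at l and v is larger at s.\<close>
        case 2
        then have "r \<in> acted l" using S(2) l by auto
        from comparable[OF s(1) l(1) s(5) this] show False
          using us vs l(2) step[OF l(1)] by (auto simp: L_def)
      qed
    qed
    ultimately show ?thesis by blast
  qed
  let ?As = "filter (\<lambda>s. QA s \<and> \<not> L s) ?ss" and ?Bs = "filter (\<lambda>s. QB s \<and> \<not> L s) ?ss"
  have inX: "r = Qubit \<or> (\<exists>S\<in>PX. r \<in> S)" if "r \<in> ?R" "r \<notin> \<Union>PY" for r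
    using that P(3) by (auto simp: PY_def registers_def)
  have acted_R: "acted s \<subseteq> ?R" if "s \<in> set ?ss" for s using ls that by (auto simp: local_steps_def)
  have indep: "({answer0 C} \<union> (\<Union>s\<in>set ?As. acted s)) \<inter> (({answer1 C} \<union> (\<Union>s\<in>set ?Bs. acted s)) - \<Union>PY) = {}"
  proof -
    have ansQ: "QA s" if "s \<in> set ?ss" "answer0 C \<in> acted s" for s
      using in_time(1) that dl by (auto simp: in_time_def reach QA_def us_def vs_def)
    have ansQ': "QB s" if "s \<in> set ?ss" "answer1 C \<in> acted s" for s
      using in_time(2) that dl by (auto simp: in_time_def reach QB_def us_def vs_def)
    have False if q: "q \<in> {answer0 C} \<union> (\<Union>s\<in>set ?As. acted s)" "q \<in> {answer1 C} \<union> (\<Union>s\<in>set ?Bs. acted s)" "q \<notin> \<Union>PY" for q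
    proof -
      have "q \<in> ?R" using q(1) r(1) acted_R by auto
      then have X: "q = Qubit \<or> (\<exists>S\<in>PX. q \<in> S)" using inX q(3) by blast
      \<comment> \<open>Of two steps sharing a register, the earlier one lies in both pasts. A step
        on an answer register lies in the past of its own deadline by
        \<open>in_time\<close>.\<close>
      have "\<exists>s\<in>set ?ss. QA s \<and> QB s \<and> \<not> L s \<and> q \<in> acted s"
      proof (cases "q = answer0 C")
        case True
        then show ?thesis using q(2) r(3) ansQ by auto
      next
        case False
        then obtain s where s: "s \<in> set ?ss" "QA s" "\<not> L s" "q \<in> acted s" using q(1) by auto
        show ?thesis
        proof (cases "q = answer1 C")
          case True
          then show ?thesis using s ansQ' by blast
        next
          case False
          then obtain s' where s': "s' \<in> set ?ss" "QB s'" "\<not> L s'" "q \<in> acted s'" using q(2) by auto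
          from comparable[OF s(1) s'(1) s(4) s'(4)] show ?thesis
          proof
            assume "us s \<le> us s' \<and> vs s \<le> vs s'"
            then have "QB s" using s'(2) by (auto simp: QB_def)
            then show ?thesis using s by blast
          next
            assume "us s' \<le> us s \<and> vs s' \<le> vs s"
            then have "QA s'" using s(2) by (auto simp: QA_def)
            then show ?thesis using s' by blast
          qed
        qed
      qed
      then show False using notL X by blast
    qed
    then show ?thesis by (intro equals0I) (elim IntE DiffE, assumption)
  qed
  have Lloc: "local_steps ?D (?R - \<Union>PY) (filter L ?ss)"
  proof -
    have "q \<notin> \<Union>PY" if s: "s \<in> set ?ss" "L s" "q \<in> acted s" for s q
    proof -
      \<comment> \<open>At v < 0 the message of V1 has not arrived.\<close>
      have "q \<noteq> Basis" using avail[OF s(1,3)] s(2) E by (auto simp: reach vs_def L_def)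
      then show ?thesis using s by (auto simp: PY_def PX_def)
    qed
    then show ?thesis using ls by (fastforce simp: local_steps_def)
  qed
  let ?P' = "insert {Basis} ?P"
  have P': "finite ?P'" "disjoint ?P'" "\<Union>?P' \<subseteq> ?R" "PY \<subseteq> ?P'" "Qubit \<notin> \<Union>PY"
    using P by (auto simp: disjoint_def PY_def registers_def)
  have PY_R: "\<Union>PY \<subseteq> ?R" using P'(3,4) by blast
  have block_psd: "psd (basis_states ?D S) (basis_block \<theta> \<tau> S)" if "S \<in> ?P'" for S \<theta>
    using psd_basis_block[OF \<tau> that] by blast
  have block_tr: "(\<Sum>a\<in>basis_states ?D S. basis_block \<theta> \<tau> S a a) = 1" if "S \<in> ?P'" "\<theta> \<in> {0,1}" for S \<theta>
    using trace_basis_block[OF \<tau> that(1), of \<theta>] that(2) D2 by auto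
  have \<kappa>_psd: "psd (basis_states ?D ?R) (\<kappa> \<theta>)" for \<theta>
    unfolding \<kappa>_def by (rule psd_block_product[OF finR P'(1)]) (use P'(3) block_psd in auto)
  have \<kappa>_tr: "(\<Sum>a\<in>basis_states ?D ?R. \<kappa> 0 a a) = 2"
  proof -
    have "?R = insert Qubit (\<Union>?P')" using P(3) by (auto simp: registers_def)
    moreover have "disjoint (insert {Qubit} ?P')" "{Qubit} \<notin> ?P'"
      using P P'(2) by (auto simp: disjoint_def)
    ultimately show ?thesis
      using trace_qubit_block_product[OF P'(1), of "basis_block 0 \<tau>" ?D] block_tr D2 by (simp add: \<kappa>_def)
  qed
  obtain Ks where Ks: "kraus_operation ?D (\<Union>PY) Ks"
    "\<And>q. agree ?D ?R (apply_kraus ?D ?R (\<Union>PY) Ks (with_qubit q (\<kappa> 0))) (with_qubit q (\<kappa> 1))"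
    "\<And>S M. S \<subseteq> ?R \<Longrightarrow> supported ?D ?R S M \<Longrightarrow> supported ?D ?R (S - \<Union>PY) (heisenberg ?D ?R (\<Union>PY) Ks M)"
    unfolding \<kappa>_def
  proof (rule block_product_reset[where D = ?D and ?\<tau>0.0 = "basis_block 0 \<tau>" and ?\<tau>1.0 = "basis_block 1 \<tau>", OF finR P'])
    show "psd (basis_states ?D S) (basis_block 1 \<tau> S)" if "S \<in> PY" for S using block_psd that P'(4) by blast
    show "(\<Sum>a\<in>basis_states ?D S. basis_block 0 \<tau> S a a) = 1" if "S \<in> PY" for S using block_tr that P'(4) by blast
    show "(\<Sum>a\<in>basis_states ?D S. basis_block 1 \<tau> S a a) = 1" if "S \<in> PY" for S using block_tr that P'(4) by blast
    \<comment> \<open>Only the block {Basis} depends on \<theta>, and it belongs to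
      \<open>PY\<close>.\<close>
    show "basis_block 0 \<tau> S = basis_block 1 \<tau> S" if "S \<in> ?P' - PY" for S
      using that by (auto simp: basis_block_def PY_def)
  qed (rule that[unfolded \<kappa>_def])
  let ?\<rho> = "\<lambda>x \<theta>. with_qubit (bb84_projector x \<theta>) (\<kappa> \<theta>)"
  have \<rho>_psd: "psd (basis_states ?D ?R) (run_steps ?D ?R ?ss (?\<rho> x \<theta>))" for x \<theta>
    unfolding with_qubit_def
    by (intro psd_run_steps finR psd_schur_product finite_basis_states \<kappa>_psd psd_of_gram[where K = "{()}" and V = "\<lambda>_ a. bb84_state \<theta> x (a Qubit)"])
      (simp add: bb84_projector_def)
  have A: "both_answers C x (run_steps ?D ?R ?ss (?\<rho> x 0))
     \<le> expect ?D ?R (outcome_op (answer0 C) (guess x)) (run_steps ?D ?R ?As (run_steps ?D ?R (filter L ?ss) (?\<rho> x 0)))" for x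
    using both_answers_le(1)[OF finR \<rho>_psd] ansA supported_outcome_op[OF r(1)] unfolding same_on_def by metis
  have B: "both_answers C x (run_steps ?D ?R ?ss (?\<rho> x 1))
     \<le> expect ?D ?R (outcome_op (answer1 C) (guess x)) (run_steps ?D ?R ?Bs (run_steps ?D ?R (filter L ?ss) (?\<rho> x 1)))" for x
    using both_answers_le(2)[OF finR \<rho>_psd] ansB supported_outcome_op[OF r(2)] unfolding same_on_def by metis
  have "(\<Sum>x\<in>{0,1}. \<Sum>\<theta>\<in>{0,1}. both_answers C x (run_steps ?D ?R ?ss (?\<rho> x \<theta>)))
      = (\<Sum>x\<in>{0,1}. both_answers C x (run_steps ?D ?R ?ss (?\<rho> x 0)))
        + (\<Sum>x\<in>{0,1}. both_answers C x (run_steps ?D ?R ?ss (?\<rho> x 1)))"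
    by simp
  also have "\<dots> \<le> (\<Sum>x\<in>{0,1}. expect ?D ?R (outcome_op (answer0 C) (guess x)) (run_steps ?D ?R ?As (run_steps ?D ?R (filter L ?ss) (?\<rho> x 0))))
      + (\<Sum>x\<in>{0,1}. expect ?D ?R (outcome_op (answer1 C) (guess x)) (run_steps ?D ?R ?Bs (run_steps ?D ?R (filter L ?ss) (?\<rho> x 1))))"
    by (intro add_mono sum_mono A B)
  also have "\<dots> \<le> 7/2"
    by (rule joint_measurement_bound[OF finR r(4) D2(1) r(1,2) PY_R Lloc _ _ indep Ks \<kappa>_psd \<kappa>_tr])
      (use ls in \<open>auto simp: local_steps_def\<close>)
  finally show ?thesis .
qed

subsection \<open>Binary entropy\<close>

lemma DERIV_bin_entropy:
  assumes "0 < p" "p < 1"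
  shows "(bin_entropy has_real_derivative log 2 ((1 - p) / p)) (at p)"
proof -
  have "((\<lambda>p. (- p * ln p - (1 - p) * ln (1 - p)) / ln 2) has_real_derivative (ln (1 - p) - ln p) / ln 2) (at p)"
    by (rule derivative_eq_intros refl | use assms in simp)+
  moreover have "bin_entropy = (\<lambda>p. (- p * ln p - (1 - p) * ln (1 - p)) / ln 2)"
    by (simp add: fun_eq_iff bin_entropy_def log_def field_simps)
  ultimately show ?thesis using assms by (simp add: log_def ln_div)
qed

lemma continuous_on_bin_entropy: "S \<subseteq> {0<..<1} \<Longrightarrow> continuous_on S bin_entropy"
  by (intro continuous_at_imp_continuous_on ballI DERIV_isCont[OF DERIV_bin_entropy]) auto

lemma bin_entropy_pos:
  assumes "0 < p" "p < 1"
  shows "0 < bin_entropy p"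
proof -
  have "p * log 2 p < 0" "(1 - p) * log 2 (1 - p) < 0"
    using assms by (auto intro: mult_pos_neg)
  then show ?thesis by (simp add: bin_entropy_def)
qed

lemma bin_entropy_strict_mono:
  assumes "0 \<le> p" "p < q" "q \<le> 1/2"
  shows "bin_entropy p < bin_entropy q"
proof (cases "p = 0")
  case True
  \<comment> \<open>The derivative formula covers only the open interval; at 0 the entropy is 0 by
    the convention for \<open>log 2 0\<close>, while it is positive at q.\<close>
  then show ?thesis using bin_entropy_pos[of q] assms by (simp add: bin_entropy_def[of 0])
next
  case False
  show ?thesis
  proof (rule DERIV_pos_imp_increasing_open[OF assms(2)])
    fix x assume x: "p < x" "x < q"
    have "0 < log 2 ((1 - x) / x)" using x assms by simp
    then show "\<exists>y. DERIV bin_entropy x :> y \<and> 0 < y"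
      using DERIV_bin_entropy[of x] x assms by auto
  qed (rule continuous_on_bin_entropy, use assms False in auto)
qed

text \<open>The value is 3/8 + 7/8 * log 2 (8/7), so the claim amounts to log 2 (8/7) \<ge> 1/7,
  that is (8/7)^7 \<ge> 2.\<close>

lemma bin_entropy_eighth: "1/2 \<le> bin_entropy (1/8)"
proof -
  have "log 2 2 \<le> log 2 ((8/7::real) ^ 7)" by (simp add: power_divide)
  then have "log 2 (7/8::real) \<le> - 1/7" by (simp add: log_nat_power log_divide)
  moreover have "log 2 (1/8::real) = - 3"
    using log_pow_cancel[of 2 3] by (simp add: log_divide)
  ultimately show ?thesis by (simp add: bin_entropy_def)
qed

text \<open>This provides a left endpoint away from 0 for the intermediate value theorem. The value
  is 6/64 + 63/64 * log 2 (64/63), at most 87/256 because (64/63)^4 \<le> 2.\<close>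

lemma bin_entropy_sixtyfourth: "bin_entropy (1/64) \<le> 1/2"
proof -
  have "log 2 ((64/63::real) ^ 4) \<le> log 2 2" by (simp add: power_divide)
  then have "- 1/4 \<le> log 2 (63/64::real)" by (simp add: log_nat_power log_divide)
  moreover have "log 2 (1/64::real) = - 6"
    using log_pow_cancel[of 2 6] by (simp add: log_divide)
  ultimately show ?thesis by (simp add: bin_entropy_def)
qed

text \<open>The intermediate value theorem supplies a preimage of 1/2 in [1/64, 1/8], and strict
  monotonicity makes it the one chosen by \<open>the_inv_into\<close>.\<close>

lemma bin_entropy_inv_half_le: "bin_entropy_inv (1/2) \<le> 1/8"
proof -
  have "\<exists>p\<ge>1/64. p \<le> 1/8 \<and> bin_entropy p = 1/2"
    by (rule IVT'[of bin_entropy, OF bin_entropy_sixtyfourth bin_entropy_eighth]) (auto intro!: continuous_on_bin_entropy)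
  then obtain p where p: "1/64 \<le> p" "p \<le> 1/8" "bin_entropy p = 1/2" by blast
  have "inj_on bin_entropy {0..1/2}"
    by (rule linorder_inj_onI) (use bin_entropy_strict_mono in fastforce)+
  then have "bin_entropy_inv (1/2) = p"
    unfolding bin_entropy_inv_def p(3)[symmetric] by (rule the_inv_into_f_f) (use p in auto)
  then show ?thesis using p by simp
qed

subsection \<open>Soundness\<close>

text \<open>Acceptance is linear in the initial state, so shared randomness only averages over
  product states, each of which obeys the bound. The value 7/8 is the factor 1/4 for uniform x and
  \<theta> times 7/2.\<close>

lemma PV_BB84_accept_le:
  assumes hull: "claimed g \<in> convex hull {pos0 g, pos1 g}" and C: "no_PE_coalition g C"
  shows "PV_BB84_accept g C \<le> 7/8"
proof (cases "in_time g C (answer0 C) (deadline0 g) \<and> in_time g C (answer1 C) (deadline1 g)")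
  case False
  show ?thesis unfolding PV_BB84_accept_def if_not_P[OF False] by simp
next
  case True
  let ?D = "dimension C" and ?R = "registers C" and ?P = "memory_blocks C"
  note P = memory_blocks_facts[OF C]
  have "separable ?D ?P (initial C)" using C by (simp add: no_PE_coalition_def)
  then obtain n :: nat and w \<tau> where w: "\<forall>j<n. 0 \<le> w j" "(\<Sum>j<n. w j) = 1"
    and \<tau>: "\<forall>j<n. \<forall>S\<in>?P. density ?D S (\<tau> j S)"
    and init: "\<forall>a\<in>basis_states ?D (memory C). \<forall>b\<in>basis_states ?D (memory C).
      initial C a b = (\<Sum>j<n. of_real (w j) * (\<Prod>S\<in>?P. \<tau> j S (restrict a S) (restrict b S)))"
    unfolding separable_def P(3) by blast
  define \<rho> where "\<rho> j x \<theta> = with_qubit (bb84_projector x \<theta>) (block_product (insert {Basis} ?P) (basis_block \<theta> (\<tau> j)))" for j x \<theta>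
  have input: "agree ?D ?R (bb84_input C x \<theta>) (\<lambda>a b. \<Sum>j<n. of_real (w j) * \<rho> j x \<theta> a b)" for x \<theta>
    unfolding agree_def
  proof (intro ballI)
    fix a b assume ab: "a \<in> basis_states ?D ?R" "b \<in> basis_states ?D ?R"
    have m: "restrict a (memory C) \<in> basis_states ?D (memory C)" "restrict b (memory C) \<in> basis_states ?D (memory C)"
      using restrict_basis_states ab by (auto simp: registers_def)
    \<comment> \<open>This makes \<open>Basis\<close> a factor of its own in the product over the
      enlarged set of blocks, matching the factor for \<theta> in \<open>bb84_input\<close>.\<close>
    have "{Basis} \<notin> ?P" using P(3,5) by blast
    then have "\<rho> j x \<theta> a b = bb84_state \<theta> x (a Qubit) * cnj (bb84_state \<theta> x (b Qubit)) *
        (if a Basis = \<theta> \<and> b Basis = \<theta> then 1 else 0) *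
        (\<Prod>S\<in>?P. \<tau> j S (restrict (restrict a (memory C)) S) (restrict (restrict b (memory C)) S))" for j
      using P(1) unfolding \<rho>_def with_qubit_def bb84_projector_def block_product_def P(3)[symmetric]
      by (auto simp: basis_block_def Int_absorb1 Union_upper intro!: prod.cong)
    then show "bb84_input C x \<theta> a b = (\<Sum>j<n. of_real (w j) * \<rho> j x \<theta> a b)"
      unfolding bb84_input_def init[rule_format, OF m] by (simp add: sum_distrib_left mult_ac)
  qed
  define F where "F j x \<theta> = both_answers C x (run_steps ?D ?R (steps C) (\<rho> j x \<theta>))" for j x \<theta>
  have run: "(\<Sum>a | a \<in> basis_states ?D ?R \<and> a (answer0 C) = x \<and> a (answer1 C) = x. run C (bb84_input C x \<theta>) a a)
      = (\<Sum>j<n. of_real (w j) * F j x \<theta>)" for x \<theta>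
  proof -
    let ?A = "{a. a \<in> basis_states ?D ?R \<and> a (answer0 C) = x \<and> a (answer1 C) = x}"
    have "(\<Sum>a\<in>?A. run C (bb84_input C x \<theta>) a a)
        = (\<Sum>a\<in>?A. \<Sum>j<n. of_real (w j) * run_steps ?D ?R (steps C) (\<rho> j x \<theta>) a a)"
      using run_steps_agree[OF input[of x \<theta>], of "steps C"]
      unfolding run_steps_sum by (intro sum.cong refl) (auto simp: agree_def run_def run_steps_def)
    also have "\<dots> = (\<Sum>j<n. \<Sum>a\<in>?A. of_real (w j) * run_steps ?D ?R (steps C) (\<rho> j x \<theta>) a a)"
      by (rule sum.swap)
    finally show ?thesis by (simp only: F_def both_answers_def sum_distrib_left)
  qed
  have bound: "(\<Sum>x\<in>{0,1}. \<Sum>\<theta>\<in>{0,1}. Re (F j x \<theta>)) \<le> 7/2" if "j < n" for j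
  proof -
    have "(\<Sum>x\<in>{0,1}. \<Sum>\<theta>\<in>{0,1}. F j x \<theta>) \<le> 7/2"
      unfolding F_def \<rho>_def using True \<tau> that by (intro product_attack_bound[OF hull C]) auto
    then show ?thesis by (simp add: less_eq_complex_def)
  qed
  have "PV_BB84_accept g C = (\<Sum>x\<in>{0,1}. \<Sum>\<theta>\<in>{0,1}. 1/4 * (\<Sum>j<n. w j * Re (F j x \<theta>)))"
    unfolding PV_BB84_accept_def if_P[OF True] run by simp
  also have "\<dots> = 1/4 * (\<Sum>j<n. w j * (\<Sum>x\<in>{0,1}. \<Sum>\<theta>\<in>{0,1}. Re (F j x \<theta>)))"
    by (simp add: sum.distrib distrib_left)
  also have "\<dots> \<le> 1/4 * (\<Sum>j<n. w j * (7/2))"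
    using w(1) bound by (intro mult_left_mono sum_mono) auto
  also have "\<dots> = 7/8" unfolding sum_distrib_right[symmetric] w(2) by simp
  finally show ?thesis .
qed

theorem theorem6p1:
  fixes p0 p1 :: real
  shows "sound_no_PE p0 p1 PV_BB84_accept (1 - bin_entropy_inv (1/2))"
  unfolding sound_no_PE_def Let_def
proof (intro ballI allI impI)
  fix pos T C
  let ?g = "\<lparr>pos0 = p0, pos1 = p1, claimed = pos, arrival = T\<rparr>"
  assume "pos \<in> convex hull {p0, p1}" "no_PE_coalition ?g C"
  then have "PV_BB84_accept ?g C \<le> 7/8" by (intro PV_BB84_accept_le) simp_all
  then show "PV_BB84_accept ?g C \<le> 1 - bin_entropy_inv (1/2)" using bin_entropy_inv_half_le by simp
qed

end
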